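(* There is a function $\delta:(0,\infty)\to(0,\infty)$ with $\delta(\epsilon)\to0$ as $\epsilon\to0$ such that the following holds. Let $(\mathcal A,\mathcal C)$ be a digraph algebra, let $\epsilon>0$, and let $v\in\mathcal A$ with $\|v\|\le1$ be an $\epsilon$-approximately normalising $\epsilon$-approximate partial isometry. Then there exists $\hat v\in N_{\mathcal C}(\mathcal A)$ with $\|\hat v-v\|<\delta(\epsilon)$.
   Context: A digraph algebra $(\mathcal A,\mathcal C)$ is a subalgebra $\mathcal A$ of some $M_n$ (complex matrices, operator norm) spanned by the standard matrix units $e_{i,j}$ with $(i,j)$ in the edge set of a reflexive transitive digraph on $\{1,\dots,n\}$, with masa $\mathcal C$ the diagonal matrices. An operator $v$ is an $\epsilon$-approximate partial isometry if $\|v^*v-(v^*v)^2\|\le\epsilon$. An element $w\in\mathcal A$ is $\epsilon$-approximately normalising if for each $c\in\mathcal C$ with $\|c\|\le1$ there exist $c_1,c_2\in\mathcal C$ with $\|w^*cw-c_1\|<\epsilon$ and $\|wcw^*-c_2\|<\epsilon$. $N_{\mathcal C}(\mathcal A)$ is the set of partial isometries $v\in\mathcal A$ with $v^*cv\in\mathcal C$ and $vcv^*\in\mathcal C$ for all $c\in\mathcal C$. *)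

theory Defs
  imports
    "Jordan_Normal_Form.Schur_Decomposition"
    "Jordan_Normal_Form.VS_Connect"
    "HOL-Analysis.L2_Norm"
begin

text \<open>
  The dimension of the matrix algebra is quantified inside the statement (the function
  \<open>\<delta>\<close> does not depend on it), so matrices carry their dimension as a term: we
  use \<open>complex mat\<close> with carrier \<open>carrier_mat n n\<close>. Vertices and matrix
  indices are \<open>0, \<dots>, n - 1\<close> instead of \<open>1, \<dots>, n\<close>.
  The adjoint is the library's \<open>mat_adjoint\<close>.
\<close>

definition vec_norm :: "complex vec \<Rightarrow> real" where
  "vec_norm x = L2_set (\<lambda>i. cmod (x $ i)) {..<dim_vec x}"

definition op_norm :: "complex mat \<Rightarrow> real" where
  "op_norm A = (SUP x \<in> {x \<in> carrier_vec (dim_col A). vec_norm x \<le> 1}. vec_norm (A *\<^sub>v x))"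

definition mat_unit :: "nat \<Rightarrow> nat \<Rightarrow> nat \<Rightarrow> complex mat" where
  "mat_unit n i j = mat n n (\<lambda>(k, l). if k = i \<and> l = j then 1 else 0)"

definition diag_masa :: "nat \<Rightarrow> complex mat set" where
  "diag_masa n = {c \<in> carrier_mat n n. diagonal_mat c}"

text \<open>
  \<open>LinearCombinations.module.span\<close> is the complex linear span in the vector space of
  \<open>n \<times> n\<close> matrices. Transitivity of \<open>E\<close> makes this span a subalgebra, reflexivity
  makes it contain the diagonal matrices.
\<close>

definition digraph_algebra :: "nat \<Rightarrow> complex mat set \<Rightarrow> complex mat set \<Rightarrow> bool" where
  "digraph_algebra n \<A> \<C> \<longleftrightarrow>
     0 < n \<and>
     (\<exists>E \<subseteq> {..<n} \<times> {..<n}. refl_on {..<n} E \<and> trans E \<and>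
        \<A> = LinearCombinations.module.span class_ring (module_mat TYPE(complex) n n)
              {mat_unit n i j | i j. (i, j) \<in> E}) \<and>
     \<C> = diag_masa n"

text \<open>A partial isometry is a \<open>v\<close> for which \<open>v\<^sup>* v\<close> is a projection.\<close>

definition projection_mat :: "complex mat \<Rightarrow> bool" where
  "projection_mat p \<longleftrightarrow> mat_adjoint p = p \<and> p * p = p"

definition partial_isometry :: "complex mat \<Rightarrow> bool" where
  "partial_isometry v \<longleftrightarrow> projection_mat (mat_adjoint v * v)"

definition approx_partial_isometry :: "real \<Rightarrow> complex mat \<Rightarrow> bool" where
  "approx_partial_isometry \<epsilon> v \<longleftrightarrow>
     op_norm (mat_adjoint v * v - (mat_adjoint v * v) * (mat_adjoint v * v)) \<le> \<epsilon>"

definition approx_normalising :: "complex mat set \<Rightarrow> real \<Rightarrow> complex mat \<Rightarrow> bool" where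
  "approx_normalising \<C> \<epsilon> w \<longleftrightarrow>
     (\<forall>c\<in>\<C>. op_norm c \<le> 1 \<longrightarrow>
        (\<exists>c\<^sub>1\<in>\<C>. \<exists>c\<^sub>2\<in>\<C>.
           op_norm (mat_adjoint w * c * w - c\<^sub>1) < \<epsilon> \<and>
           op_norm (w * c * mat_adjoint w - c\<^sub>2) < \<epsilon>))"

definition normaliser :: "complex mat set \<Rightarrow> complex mat set \<Rightarrow> complex mat set" where
  "normaliser \<C> \<A> =
     {v \<in> \<A>. partial_isometry v \<and>
        (\<forall>c\<in>\<C>. mat_adjoint v * c * v \<in> \<C> \<and> v * c * mat_adjoint v \<in> \<C>)}"

end

theory Submission
  imports Defs
begin

text \<open>
  Let \<open>p = v\<^sup>* v\<close>, let \<open>t\<^sub>j\<close> be the squared norm of the \<open>j\<close>-th column of \<open>v\<close>, and let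
  \<open>\<sigma>(j)\<close> be a row in which that column has an entry of largest modulus. The idea is that
  conjugation by \<open>v\<close> almost maps diagonal matrices to diagonal matrices, hence acts on them
  almost as composition with \<open>\<sigma>\<close>, so that \<open>v\<close> nearly vanishes off the graph of \<open>\<sigma>\<close>. Deleting and
  rescaling entries then produces a normalising partial isometry. The difficulty is that all
  estimates have to hold in operator norm, independently of the dimension: closeness of
  single entries or single columns is not enough. The argument is as follows.

  First, the columns concentrate. The rank one matrix \<open>v e\<^sub>j\<^sub>j v\<^sup>*\<close> is within \<open>\<epsilon>\<close> of a diagonal matrix;
  evaluating it at the column itself shows that all but \<open>2\<epsilon>\<close> of the mass \<open>t\<^sub>j\<close> sits at the
  single entry \<open>(\<sigma>(j), j)\<close> (\<open>mass_concentrates\<close>).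

  Secondly, let \<open>d\<close> be a diagonal matrix of signs and let \<open>s\<close> be the diagonal matrix with entries
  \<open>s\<^sub>j = d\<^bsub>\<sigma>(j)\<^esub>\<close>. The matrix \<open>v\<^sup>* d v\<close> is nearly diagonal, and by concentration its diagonal
  is nearly \<open>t\<^sub>j d\<^bsub>\<sigma>(j)\<^esub>\<close>; as \<open>p\<close> is nearly the diagonal matrix of the \<open>t\<^sub>j\<close>, the matrices
  \<open>v\<^sup>* d v\<close> and \<open>p s\<close> are close. Multiplying by \<open>v\<close> from the left, and using that \<open>v v\<^sup>*\<close> is nearly
  diagonal and so nearly commutes with \<open>d\<close>, and that \<open>v p\<close> is close to \<open>v\<close>, gives
  \<open>d v \<approx> v s\<close>, that is \<open>v \<approx> d v s\<close>, with an error that does not depend on \<open>d\<close> or \<open>n\<close>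
  (\<open>sign_intertwining\<close>).

  Thirdly, averaging \<open>d v s\<close> over all \<open>2\<^sup>n\<close> choices of signs kills exactly the entries \<open>(i, j)\<close> with
  \<open>i \<noteq> \<sigma>(j)\<close>. The operator norm is convex, so \<open>v\<close> is close to its restriction \<open>w\<close> to the graph
  of \<open>\<sigma>\<close> (\<open>op_norm_sign_average\<close>). This is the step that converts uniform estimates into an
  operator norm estimate on the whole off-graph part.

  Finally, \<open>t\<^sub>j\<close> is nearly idempotent, so the dominant entry of each column has modulus near \<open>0\<close>
  or near \<open>1\<close>. The columns of the first kind are removed at the cost of a small
  \<open>\<parallel>v q\<parallel>\<close>, where \<open>q\<close> is the diagonal projection onto them, because \<open>q p q\<close> is small. On the others
  \<open>\<sigma>\<close> is injective, since two entries of modulus above \<open>1/2\<close> in one row would contradict the near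
  diagonality of \<open>v\<^sup>* e\<^sub>i\<^sub>i v\<close>; hence rescaling these entries to modulus one changes the operator norm
  by at most the largest change of an entry (\<open>op_norm_partial_matching_le\<close>). The result is supported
  where \<open>v\<close> is, so it lies in the same digraph algebra. All this is for \<open>\<epsilon> \<le> 1/8\<close> and
  gives \<open>\<delta>(\<epsilon>) = 26\<epsilon> + 6\<surd>\<epsilon>\<close>, where the square roots come from the C*-identity; for larger
  \<open>\<epsilon>\<close> this exceeds \<open>1\<close>, and the zero matrix suffices.
\<close>


section \<open>The Euclidean norm and the operator norm\<close>

lemma vec_norm_nonneg [simp]: "0 \<le> vec_norm x"
  by (simp add: vec_norm_def)

lemma vec_norm_sq: "(vec_norm x)\<^sup>2 = (\<Sum>i<dim_vec x. (cmod (x $ i))\<^sup>2)"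
  by (simp add: vec_norm_def L2_set_def sum_nonneg)

lemma vec_norm_smult: "vec_norm (a \<cdot>\<^sub>v x) = cmod a * vec_norm x"
proof -
  have "vec_norm (a \<cdot>\<^sub>v x) = L2_set (\<lambda>i. cmod a * cmod (x $ i)) {..<dim_vec x}"
    by (auto simp: vec_norm_def norm_mult intro!: L2_set_cong)
  then show ?thesis by (simp add: vec_norm_def L2_set_right_distrib)
qed

lemma vec_norm_triangle:
  assumes "x \<in> carrier_vec n" "y \<in> carrier_vec n"
  shows "vec_norm (x + y) \<le> vec_norm x + vec_norm y"
proof -
  have "vec_norm (x + y) = L2_set (\<lambda>i. cmod (x $ i + y $ i)) {..<n}"
    using assms by (auto simp: vec_norm_def intro!: L2_set_cong)
  also have "\<dots> \<le> L2_set (\<lambda>i. cmod (x $ i) + cmod (y $ i)) {..<n}"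
    by (intro L2_set_mono norm_triangle_ineq) auto
  also have "\<dots> \<le> vec_norm x + vec_norm y"
    using assms L2_set_triangle_ineq by (auto simp: vec_norm_def)
  finally show ?thesis .
qed

lemma vec_norm_le_sum: "vec_norm x \<le> (\<Sum>i<dim_vec x. cmod (x $ i))"
  unfolding vec_norm_def by (rule L2_set_le_sum) auto

lemma cmod_index_le_vec_norm: "i < dim_vec x \<Longrightarrow> cmod (x $ i) \<le> vec_norm x"
  unfolding vec_norm_def by (rule member_le_L2_set) auto

lemma vec_norm_eq_0: "x \<in> carrier_vec n \<Longrightarrow> vec_norm x = 0 \<Longrightarrow> x = 0\<^sub>v n"
  using cmod_index_le_vec_norm[of _ x] by (intro eq_vecI) force+

lemma vec_norm_Cauchy_Schwarz:
  assumes "x \<in> carrier_vec n" "y \<in> carrier_vec n"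
  shows "cmod (\<Sum>i<n. cnj (x $ i) * y $ i) \<le> vec_norm x * vec_norm y"
proof -
  have "cmod (\<Sum>i<n. cnj (x $ i) * y $ i) \<le> (\<Sum>i<n. \<bar>cmod (x $ i)\<bar> * \<bar>cmod (y $ i)\<bar>)"
    by (rule order_trans[OF norm_sum]) (simp add: norm_mult)
  also have "\<dots> \<le> vec_norm x * vec_norm y"
    using assms L2_set_mult_ineq[of "\<lambda>i. cmod (x $ i)" "\<lambda>i. cmod (y $ i)" "{..<n}"]
    by (auto simp: vec_norm_def)
  finally show ?thesis .
qed

lemma mult_mat_vec_index:
  assumes "A \<in> carrier_mat m n" "x \<in> carrier_vec n" "i < m"
  shows "(A *\<^sub>v x) $ i = (\<Sum>j<n. A $$ (i, j) * x $ j)"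
  using assms by (simp add: scalar_prod_def atLeast0LessThan)

lemma mult_mat_index:
  assumes "A \<in> carrier_mat m n" "B \<in> carrier_mat n k" "i < m" "j < k"
  shows "(A * B) $$ (i, j) = (\<Sum>l<n. A $$ (i, l) * B $$ (l, j))"
  using assms by (simp add: scalar_prod_def atLeast0LessThan)

text \<open>
  A crude bound; its only purpose is that the supremum defining the operator norm is
  taken over a bounded set.
\<close>
lemma mult_mat_vec_norm_bound:
  fixes A :: "complex mat"
  assumes "A \<in> carrier_mat m n" "x \<in> carrier_vec n" "vec_norm x \<le> 1"
  shows "vec_norm (A *\<^sub>v x) \<le> (\<Sum>i<m. \<Sum>j<n. cmod (A $$ (i, j)))"
proof -
  have "vec_norm (A *\<^sub>v x) \<le> (\<Sum>i<m. cmod ((A *\<^sub>v x) $ i))"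
    using vec_norm_le_sum[of "A *\<^sub>v x"] assms by simp
  also have "\<dots> \<le> (\<Sum>i<m. \<Sum>j<n. cmod (A $$ (i, j)))"
  proof (rule sum_mono)
    fix i assume "i \<in> {..<m}"
    then have "cmod ((A *\<^sub>v x) $ i) = cmod (\<Sum>j<n. A $$ (i, j) * x $ j)"
      using mult_mat_vec_index[OF assms(1,2)] by simp
    also have "\<dots> \<le> (\<Sum>j<n. cmod (A $$ (i, j) * x $ j))" by (rule norm_sum)
    also have "\<dots> \<le> (\<Sum>j<n. cmod (A $$ (i, j)))"
    proof (rule sum_mono)
      fix j assume "j \<in> {..<n}"
      then have "cmod (x $ j) \<le> 1"
        using cmod_index_le_vec_norm[of j x] assms by simp
      then show "cmod (A $$ (i, j) * x $ j) \<le> cmod (A $$ (i, j))"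
        by (simp add: norm_mult mult_left_le)
    qed
    finally show "cmod ((A *\<^sub>v x) $ i) \<le> (\<Sum>j<n. cmod (A $$ (i, j)))" .
  qed
  finally show ?thesis .
qed

lemma op_norm_bdd:
  assumes "A \<in> carrier_mat m n"
  shows "bdd_above ((\<lambda>x. vec_norm (A *\<^sub>v x)) ` {x \<in> carrier_vec n. vec_norm x \<le> 1})"
  using mult_mat_vec_norm_bound[OF assms] by (intro bdd_aboveI2) auto

lemma op_norm_mult_mat_vec:
  assumes A: "A \<in> carrier_mat m n" and x: "x \<in> carrier_vec n"
  shows "vec_norm (A *\<^sub>v x) \<le> op_norm A * vec_norm x"
proof (cases "vec_norm x = 0")
  case True
  then have "A *\<^sub>v x = 0\<^sub>v m" using vec_norm_eq_0[OF x] A by auto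
  then show ?thesis using True by (simp add: vec_norm_def L2_set_def)
next
  case False
  define a where "a = complex_of_real (inverse (vec_norm x))"
  have "0 < vec_norm x" using False vec_norm_nonneg[of x] by linarith
  then have ca: "cmod a = inverse (vec_norm x)"
    by (simp add: a_def norm_inverse)
  have 1: "vec_norm (a \<cdot>\<^sub>v x) \<le> 1" using False by (simp add: vec_norm_smult ca)
  have "vec_norm (A *\<^sub>v (a \<cdot>\<^sub>v x)) \<le> op_norm A"
    using A x 1 op_norm_bdd[OF A] unfolding op_norm_def by (intro cSUP_upper) auto
  then have "inverse (vec_norm x) * vec_norm (A *\<^sub>v x) \<le> op_norm A"
    using A x by (simp add: mult_mat_vec vec_norm_smult ca)
  then show ?thesis using \<open>0 < vec_norm x\<close> by (simp add: field_simps)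
qed

lemma op_norm_leI:
  assumes A: "A \<in> carrier_mat m n" and "0 \<le> K"
    and "\<And>x. x \<in> carrier_vec n \<Longrightarrow> vec_norm (A *\<^sub>v x) \<le> K * vec_norm x"
  shows "op_norm A \<le> K"
  unfolding op_norm_def
proof (rule cSUP_least)
  have "0\<^sub>v n \<in> {x \<in> carrier_vec (dim_col A). vec_norm x \<le> 1}"
    using A by (simp add: vec_norm_def L2_set_def)
  then show "{x \<in> carrier_vec (dim_col A). vec_norm x \<le> 1} \<noteq> {}" by blast
next
  fix x assume x: "x \<in> {x \<in> carrier_vec (dim_col A). vec_norm x \<le> 1}"
  then have "vec_norm (A *\<^sub>v x) \<le> K * vec_norm x" using assms by auto
  also have "\<dots> \<le> K" using x \<open>0 \<le> K\<close> by (simp add: mult_left_le)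
  finally show "vec_norm (A *\<^sub>v x) \<le> K" .
qed

lemma vec_norm_col_le_op_norm:
  assumes A: "A \<in> carrier_mat m n" and "j < n"
  shows "vec_norm (col A j) \<le> op_norm A"
proof -
  have "(\<Sum>i<n. (cmod (unit_vec n j $ i :: complex))\<^sup>2) = (\<Sum>i<n. if i = j then 1 else 0)"
    by (intro sum.cong) (auto simp: unit_vec_def)
  then have "(vec_norm (unit_vec n j))\<^sup>2 = 1"
    using \<open>j < n\<close> by (simp add: vec_norm_sq)
  then have "vec_norm (unit_vec n j) = 1"
    by (simp add: power2_eq_1_iff) (metis vec_norm_nonneg not_one_le_zero neg_0_le_iff_le)
  moreover have "col A j = A *\<^sub>v unit_vec n j"
    using col_mult2[OF A one_carrier_mat \<open>j < n\<close>] A \<open>j < n\<close> by simp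
  ultimately show ?thesis
    using op_norm_mult_mat_vec[OF A, of "unit_vec n j"] by simp
qed

lemma op_norm_nonneg:
  assumes A: "A \<in> carrier_mat m n"
  shows "0 \<le> op_norm A"
proof -
  have "vec_norm (A *\<^sub>v 0\<^sub>v n) \<le> op_norm A"
    using A op_norm_bdd[OF A] unfolding op_norm_def
    by (intro cSUP_upper) (auto simp: vec_norm_def L2_set_def)
  then show ?thesis using vec_norm_nonneg[of "A *\<^sub>v 0\<^sub>v n"] by linarith
qed

lemma cmod_index_le_op_norm:
  assumes "A \<in> carrier_mat m n" "i < m" "j < n"
  shows "cmod (A $$ (i, j)) \<le> op_norm A"
  using vec_norm_col_le_op_norm[OF assms(1,3)] cmod_index_le_vec_norm[of i "col A j"] assms
  by simp

lemma op_norm_zero: "op_norm (0\<^sub>m n n) = 0"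
proof (rule antisym)
  show "op_norm (0\<^sub>m n n) \<le> 0"
    by (rule op_norm_leI[of _ n n]) (auto simp: vec_norm_def L2_set_def)
qed (rule op_norm_nonneg[of _ n n], simp)

lemma op_norm_triangle:
  assumes A: "A \<in> carrier_mat n n" and B: "B \<in> carrier_mat n n"
  shows "op_norm (A + B) \<le> op_norm A + op_norm B"
proof (rule op_norm_leI[of _ n n])
  show "0 \<le> op_norm A + op_norm B" using op_norm_nonneg A B by simp
  fix x :: "complex vec" assume x: "x \<in> carrier_vec n"
  have "vec_norm ((A + B) *\<^sub>v x) = vec_norm (A *\<^sub>v x + B *\<^sub>v x)"
    using add_mult_distrib_mat_vec[OF A B x] by simp
  also have "\<dots> \<le> vec_norm (A *\<^sub>v x) + vec_norm (B *\<^sub>v x)"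
    using A B x by (intro vec_norm_triangle[of _ n] mult_mat_vec_carrier)
  also have "\<dots> \<le> op_norm A * vec_norm x + op_norm B * vec_norm x"
    using A B x by (intro add_mono op_norm_mult_mat_vec) auto
  finally show "vec_norm ((A + B) *\<^sub>v x) \<le> (op_norm A + op_norm B) * vec_norm x"
    by (simp add: algebra_simps)
qed (use A B in auto)

lemma op_norm_mult:
  assumes A: "A \<in> carrier_mat n n" and B: "B \<in> carrier_mat n n"
  shows "op_norm (A * B) \<le> op_norm A * op_norm B"
proof (rule op_norm_leI[of _ n n])
  show "0 \<le> op_norm A * op_norm B" using op_norm_nonneg A B by simp
  fix x :: "complex vec" assume x: "x \<in> carrier_vec n"
  have "vec_norm ((A * B) *\<^sub>v x) = vec_norm (A *\<^sub>v (B *\<^sub>v x))"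
    using assoc_mult_mat_vec[OF A B x] by simp
  also have "\<dots> \<le> op_norm A * vec_norm (B *\<^sub>v x)"
    using A B x by (intro op_norm_mult_mat_vec) auto
  also have "\<dots> \<le> op_norm A * (op_norm B * vec_norm x)"
    using A B x by (intro mult_left_mono op_norm_mult_mat_vec op_norm_nonneg) auto
  finally show "vec_norm ((A * B) *\<^sub>v x) \<le> op_norm A * op_norm B * vec_norm x"
    by (simp add: algebra_simps)
qed (use A B in auto)

lemma op_norm_smult:
  assumes A: "A \<in> carrier_mat n n"
  shows "op_norm (a \<cdot>\<^sub>m A) \<le> cmod a * op_norm A"
proof (rule op_norm_leI[of _ n n])
  show "0 \<le> cmod a * op_norm A" using op_norm_nonneg A by simp
  fix x :: "complex vec" assume x: "x \<in> carrier_vec n"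
  have "(a \<cdot>\<^sub>m A) *\<^sub>v x = a \<cdot>\<^sub>v (A *\<^sub>v x)"
    using A x by (intro eq_vecI) auto
  then show "vec_norm ((a \<cdot>\<^sub>m A) *\<^sub>v x) \<le> cmod a * op_norm A * vec_norm x"
    using op_norm_mult_mat_vec[OF A x] by (simp add: vec_norm_smult mult_left_mono mult.assoc)
qed (use A in auto)

lemma op_norm_minus_commute:
  assumes A: "A \<in> carrier_mat n n" and B: "B \<in> carrier_mat n n"
  shows "op_norm (A - B) = op_norm (B - A)"
proof -
  have *: "op_norm (X - Y) \<le> op_norm (Y - X)"
    if "X \<in> carrier_mat n n" "Y \<in> carrier_mat n n" for X Y
  proof -
    have "X - Y = (-1) \<cdot>\<^sub>m (Y - X)" using that by (intro eq_matI) auto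
    then show ?thesis using op_norm_smult[of "Y - X" n "-1"] that
      by (simp add: minus_carrier_mat)
  qed
  show ?thesis using *[OF A B] *[OF B A] by simp
qed

text \<open>
  The estimates below are chains of approximations, so they rest on the triangle inequality for
  distances and on the fact that multiplication by a contraction does not increase distances.
\<close>
lemma op_norm_diff_triangle:
  assumes "A \<in> carrier_mat n n" "B \<in> carrier_mat n n" "C \<in> carrier_mat n n"
    and "op_norm (A - B) \<le> a" "op_norm (B - C) \<le> b"
  shows "op_norm (A - C) \<le> a + b"
proof -
  have "A - C = (A - B) + (B - C)" using assms by (intro eq_matI) auto
  then show ?thesis using op_norm_triangle[of "A - B" n "B - C"] assms
    by (simp add: minus_carrier_mat)
qed

lemma op_norm_diff_le:
  assumes "A \<in> carrier_mat n n" "B \<in> carrier_mat n n"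
  shows "op_norm (A - B) \<le> op_norm A + op_norm B"
proof -
  have "A - B = A + (-1) \<cdot>\<^sub>m B" using assms by (intro eq_matI) auto
  then show ?thesis
    using op_norm_triangle[of A n "(-1) \<cdot>\<^sub>m B"] op_norm_smult[of B n "-1"] assms by auto
qed

lemma op_norm_mult_diff_left:
  assumes "X \<in> carrier_mat n n" "A \<in> carrier_mat n n" "B \<in> carrier_mat n n"
    and "op_norm X \<le> 1" "op_norm (A - B) \<le> a"
  shows "op_norm (X * A - X * B) \<le> a"
proof -
  have "X * A - X * B = X * (A - B)" using assms mult_minus_distrib_mat by metis
  then have "op_norm (X * A - X * B) \<le> op_norm X * op_norm (A - B)"
    using op_norm_mult[of X n "A - B"] assms by (simp add: minus_carrier_mat)
  also have "\<dots> \<le> 1 * a" using assms op_norm_nonneg[OF minus_carrier_mat, of B n n A]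
    by (intro mult_mono) auto
  finally show ?thesis by simp
qed

lemma op_norm_mult_diff_right:
  assumes "X \<in> carrier_mat n n" "A \<in> carrier_mat n n" "B \<in> carrier_mat n n"
    and "op_norm X \<le> 1" "op_norm (A - B) \<le> a"
  shows "op_norm (A * X - B * X) \<le> a"
proof -
  have "A * X - B * X = (A - B) * X" using assms minus_mult_distrib_mat by metis
  then have "op_norm (A * X - B * X) \<le> op_norm (A - B) * op_norm X"
    using op_norm_mult[of "A - B" n X] assms by (simp add: minus_carrier_mat)
  also have "\<dots> \<le> a * 1" using assms op_norm_nonneg[OF minus_carrier_mat, of B n n A] op_norm_nonneg[of X n n]
    by (intro mult_mono) auto
  finally show ?thesis by simp
qed

lemma op_norm_sum:
  assumes "finite F" "\<And>a. a \<in> F \<Longrightarrow> G a \<in> carrier_mat n n"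
  shows "op_norm (mat n n (\<lambda>ij. \<Sum>a\<in>F. G a $$ ij)) \<le> (\<Sum>a\<in>F. op_norm (G a))"
  using assms
proof (induction F)
  case empty
  have "mat n n (\<lambda>ij. 0) = (0\<^sub>m n n :: complex mat)" by (intro eq_matI) auto
  then show ?case by (simp add: op_norm_zero)
next
  case (insert b F)
  have "mat n n (\<lambda>ij. \<Sum>a\<in>insert b F. G a $$ ij) = G b + mat n n (\<lambda>ij. \<Sum>a\<in>F. G a $$ ij)"
    using insert.hyps insert.prems[of b] by (intro eq_matI) auto
  then show ?case
    using op_norm_triangle[of "G b" n "mat n n (\<lambda>ij. \<Sum>a\<in>F. G a $$ ij)"] insert by force
qed

lemma op_norm_mat_diag_le:
  assumes "0 \<le> K" "\<And>i. i < n \<Longrightarrow> cmod (f i) \<le> K"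
  shows "op_norm (mat_diag n f) \<le> K"
proof (rule op_norm_leI[of _ n n])
  fix x :: "complex vec" assume x: "x \<in> carrier_vec n"
  have idx: "(mat_diag n f *\<^sub>v x) $ i = f i * x $ i" if "i < n" for i
  proof -
    have "(mat_diag n f *\<^sub>v x) $ i = (\<Sum>j<n. (mat_diag n f) $$ (i, j) * x $ j)"
      by (rule mult_mat_vec_index[OF mat_diag_dim x that])
    also have "\<dots> = (\<Sum>j<n. if i = j then f i * x $ i else 0)"
      using that by (intro sum.cong) (auto simp: mat_diag_def)
    finally show ?thesis using that by simp
  qed
  have "vec_norm (mat_diag n f *\<^sub>v x) = L2_set (\<lambda>i. cmod (f i * x $ i)) {..<n}"
    using idx by (auto simp: vec_norm_def mat_diag_def intro!: L2_set_cong)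
  also have "\<dots> \<le> L2_set (\<lambda>i. K * cmod (x $ i)) {..<n}"
    using assms by (intro L2_set_mono) (auto simp: norm_mult mult_right_mono)
  also have "\<dots> = K * vec_norm x"
    using x assms by (simp add: vec_norm_def L2_set_right_distrib)
  finally show "vec_norm (mat_diag n f *\<^sub>v x) \<le> K * vec_norm x" .
qed (use assms in auto)

section \<open>The adjoint and the C*-identity\<close>

lemma mat_adjoint_carrier [simp]:
  "A \<in> carrier_mat m n \<Longrightarrow> mat_adjoint A \<in> carrier_mat n m"
  by (auto simp: mat_adjoint_def)

lemma index_mat_adjoint:
  assumes "A \<in> carrier_mat m n" "i < n" "j < m"
  shows "mat_adjoint A $$ (i, j) = cnj (A $$ (j, i))"
  using assms by (auto simp: mat_adjoint_def mat_of_rows_def)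

lemma inner_adjoint:
  assumes A: "A \<in> carrier_mat n n" and x: "x \<in> carrier_vec n" and y: "y \<in> carrier_vec n"
  shows "(\<Sum>i<n. cnj (x $ i) * (A *\<^sub>v y) $ i)
       = (\<Sum>j<n. cnj ((mat_adjoint A *\<^sub>v x) $ j) * y $ j)"
proof -
  have "(\<Sum>i<n. cnj (x $ i) * (A *\<^sub>v y) $ i)
      = (\<Sum>i<n. \<Sum>j<n. cnj (x $ i) * A $$ (i, j) * y $ j)"
    using mult_mat_vec_index[OF A y] by (simp add: sum_distrib_left mult.assoc)
  also have "\<dots> = (\<Sum>j<n. \<Sum>i<n. cnj (x $ i) * A $$ (i, j) * y $ j)"
    by (rule sum.swap)
  also have "\<dots> = (\<Sum>j<n. cnj ((mat_adjoint A *\<^sub>v x) $ j) * y $ j)"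
  proof (rule sum.cong)
    fix j assume "j \<in> {..<n}"
    then have "(mat_adjoint A *\<^sub>v x) $ j = (\<Sum>i<n. cnj (A $$ (i, j)) * x $ i)"
      using mult_mat_vec_index[of "mat_adjoint A" n n x j] A x by (simp add: index_mat_adjoint)
    then show "(\<Sum>i<n. cnj (x $ i) * A $$ (i, j) * y $ j) = cnj ((mat_adjoint A *\<^sub>v x) $ j) * y $ j"
      by (simp add: sum_distrib_left mult_ac)
  qed simp
  finally show ?thesis .
qed

lemma inner_self: "x \<in> carrier_vec n \<Longrightarrow> (\<Sum>i<n. cnj (x $ i) * x $ i) = complex_of_real ((vec_norm x)\<^sup>2)"
  unfolding vec_norm_sq of_real_sum complex_norm_square by (auto simp: mult.commute)

lemma mat_adjoint_adjoint:
  assumes A: "A \<in> carrier_mat m n"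
  shows "mat_adjoint (mat_adjoint A) = (A :: complex mat)"
proof (rule eq_matI)
  note A1 = mat_adjoint_carrier[OF A]
  note A2 = mat_adjoint_carrier[OF A1]
  show "dim_row (mat_adjoint (mat_adjoint A)) = dim_row A"
    and "dim_col (mat_adjoint (mat_adjoint A)) = dim_col A"
    using carrier_matD[OF A] carrier_matD[OF A2] by simp_all
  show "mat_adjoint (mat_adjoint A) $$ (i, j) = A $$ (i, j)"
    if "i < dim_row A" "j < dim_col A" for i j
    using that A by (simp add: index_mat_adjoint[OF A1] index_mat_adjoint[OF A])
qed

lemma op_norm_adjoint_le:
  assumes A: "A \<in> carrier_mat n n"
  shows "op_norm (mat_adjoint A) \<le> op_norm A"
proof (rule op_norm_leI[of _ n n])
  fix x :: "complex vec" assume x: "x \<in> carrier_vec n"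
  define y where "y = mat_adjoint A *\<^sub>v x"
  have y: "y \<in> carrier_vec n" using A x by (auto simp: y_def intro: mult_mat_vec_carrier[of _ n n])
  have "complex_of_real ((vec_norm y)\<^sup>2) = (\<Sum>i<n. cnj (x $ i) * (A *\<^sub>v y) $ i)"
    using inner_adjoint[OF A x y] inner_self[OF y] by (simp add: y_def)
  then have "(vec_norm y)\<^sup>2 = cmod (\<Sum>i<n. cnj (x $ i) * (A *\<^sub>v y) $ i)"
    by (metis abs_power2 norm_of_real)
  also have "\<dots> \<le> vec_norm x * vec_norm (A *\<^sub>v y)"
    using A x y by (intro vec_norm_Cauchy_Schwarz) auto
  also have "\<dots> \<le> vec_norm x * (op_norm A * vec_norm y)"
    by (intro mult_left_mono op_norm_mult_mat_vec[OF A y]) simp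
  finally have "vec_norm y * vec_norm y \<le> (op_norm A * vec_norm x) * vec_norm y"
    by (simp add: power2_eq_square algebra_simps)
  then show "vec_norm (mat_adjoint A *\<^sub>v x) \<le> op_norm A * vec_norm x"
    unfolding y_def[symmetric]
    using op_norm_nonneg[OF A] vec_norm_nonneg[of x] vec_norm_nonneg[of y]
    by (metis mult_le_cancel_right mult_nonneg_nonneg order_le_less)
qed (use op_norm_nonneg[OF A] A in auto)

text \<open>
  The inequality from which the C*-identity follows, by
  \<open>\<parallel>A x\<parallel>\<^sup>2 = \<langle>A\<^sup>*A x, x\<rangle> \<le> \<parallel>A\<^sup>*A\<parallel> \<parallel>x\<parallel>\<^sup>2\<close>.
\<close>
lemma op_norm_sq_le:
  assumes A: "A \<in> carrier_mat n n"
  shows "(op_norm A)\<^sup>2 \<le> op_norm (mat_adjoint A * A)"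
proof -
  let ?p = "mat_adjoint A * A"
  have p: "?p \<in> carrier_mat n n" using A by (auto intro: mult_carrier_mat[of _ n n])
  have "op_norm A \<le> sqrt (op_norm ?p)"
  proof (rule op_norm_leI[OF A])
    fix x :: "complex vec" assume x: "x \<in> carrier_vec n"
    define y where "y = A *\<^sub>v x"
    have y: "y \<in> carrier_vec n" using A x by (auto simp: y_def)
    have "mat_adjoint A *\<^sub>v y = ?p *\<^sub>v x"
      using assoc_mult_mat_vec[OF mat_adjoint_carrier[OF A] A x] by (simp add: y_def)
    then have "complex_of_real ((vec_norm y)\<^sup>2) = (\<Sum>i<n. cnj ((?p *\<^sub>v x) $ i) * x $ i)"
      using inner_adjoint[OF A y x] inner_self[OF y] by (simp add: y_def)
    then have "(vec_norm y)\<^sup>2 = cmod (\<Sum>i<n. cnj ((?p *\<^sub>v x) $ i) * x $ i)"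
      by (metis abs_power2 norm_of_real)
    also have "\<dots> \<le> vec_norm (?p *\<^sub>v x) * vec_norm x"
      using p x by (intro vec_norm_Cauchy_Schwarz) (auto intro: mult_mat_vec_carrier)
    also have "\<dots> \<le> (op_norm ?p * vec_norm x) * vec_norm x"
      by (intro mult_right_mono op_norm_mult_mat_vec[OF p x]) simp
    also have "\<dots> = (sqrt (op_norm ?p) * vec_norm x)\<^sup>2"
      using op_norm_nonneg[OF p] by (simp add: power2_eq_square)
    finally show "vec_norm (A *\<^sub>v x) \<le> sqrt (op_norm ?p) * vec_norm x"
      unfolding y_def[symmetric] using op_norm_nonneg[OF p] by (auto intro: power2_le_imp_le)
  qed (use op_norm_nonneg[OF p] in auto)
  then have "(op_norm A)\<^sup>2 \<le> (sqrt (op_norm ?p))\<^sup>2"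
    using op_norm_nonneg[OF A] by (intro power_mono) auto
  then show ?thesis using op_norm_nonneg[OF p] by simp
qed

lemma mat_adjoint_minus:
  fixes A :: "complex mat"
  assumes A: "A \<in> carrier_mat m n" and B: "B \<in> carrier_mat m n"
  shows "mat_adjoint (A - B) = mat_adjoint A - mat_adjoint B"
  using carrier_matD[OF A] carrier_matD[OF B]
    carrier_matD[OF mat_adjoint_carrier[OF minus_carrier_mat[OF B, of A]]]
    carrier_matD[OF mat_adjoint_carrier[OF A]] carrier_matD[OF mat_adjoint_carrier[OF B]]
  by (intro eq_matI)
    (simp_all add: index_mat_adjoint[OF A] index_mat_adjoint[OF B]
      index_mat_adjoint[OF minus_carrier_mat[OF B, of A]])

lemma mat_adjoint_mult:
  fixes A :: "complex mat"
  assumes A: "A \<in> carrier_mat m n" and B: "B \<in> carrier_mat n k"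
  shows "mat_adjoint (A * B) = mat_adjoint B * mat_adjoint A"
proof (rule eq_matI)
  note AB = mult_carrier_mat[OF A B]
  note A' = mat_adjoint_carrier[OF A] and B' = mat_adjoint_carrier[OF B]
  show "dim_row (mat_adjoint (A * B)) = dim_row (mat_adjoint B * mat_adjoint A)"
    and "dim_col (mat_adjoint (A * B)) = dim_col (mat_adjoint B * mat_adjoint A)"
    using carrier_matD[OF mat_adjoint_carrier[OF AB]] carrier_matD[OF A'] carrier_matD[OF B']
    by simp_all
  fix i j assume "i < dim_row (mat_adjoint B * mat_adjoint A)"
    "j < dim_col (mat_adjoint B * mat_adjoint A)"
  then have i: "i < k" and j: "j < m" using carrier_matD[OF A'] carrier_matD[OF B'] by simp_all
  show "mat_adjoint (A * B) $$ (i, j) = (mat_adjoint B * mat_adjoint A) $$ (i, j)"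
    unfolding index_mat_adjoint[OF AB i j] mult_mat_index[OF A B j i] mult_mat_index[OF B' A' i j]
    using i j by (simp add: index_mat_adjoint[OF A] index_mat_adjoint[OF B] mult.commute)
qed

section \<open>Diagonal matrices\<close>

lemma index_mat_diag [simp]:
  "i < n \<Longrightarrow> j < n \<Longrightarrow> mat_diag n f $$ (i, j) = (if i = j then f j else 0)"
  by (simp add: mat_diag_def)

lemma dim_mat_diag [simp]: "dim_row (mat_diag n f) = n" "dim_col (mat_diag n f) = n"
  by (simp_all add: mat_diag_def)

lemma mat_adjoint_mat_diag: "mat_adjoint (mat_diag n f) = mat_diag n (\<lambda>i. cnj (f i))"
  using carrier_matD[OF mat_adjoint_carrier[OF mat_diag_dim[of n f]]]
  by (intro eq_matI) (auto simp: index_mat_adjoint[OF mat_diag_dim])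

lemma mat_diag_in_masa: "mat_diag n f \<in> diag_masa n"
  by (simp add: diag_masa_def diagonal_mat_def mat_diag_def)

lemma masa_eq_mat_diag: "c \<in> diag_masa n \<Longrightarrow> c = mat_diag n (\<lambda>i. c $$ (i, i))"
  by (intro eq_matI) (auto simp: diag_masa_def diagonal_mat_def mat_diag_def)

lemma index_adjoint_diag_mult:
  assumes v: "v \<in> carrier_mat n n" and "j < n" "k < n"
  shows "(mat_adjoint v * mat_diag n f * v) $$ (j, k) = (\<Sum>i<n. f i * (cnj (v $$ (i, j)) * v $$ (i, k)))"
  unfolding mat_diag_mult_right[OF mat_adjoint_carrier[OF v]]
  using assms by (subst mult_mat_index[of _ n n _ n])
    (auto simp: index_mat_adjoint mult_ac intro!: sum.cong)

lemma index_mult_diag_adjoint: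
  assumes v: "v \<in> carrier_mat n n" and "i < n" "k < n"
  shows "(v * mat_diag n f * mat_adjoint v) $$ (i, k) = (\<Sum>j<n. f j * (v $$ (i, j) * cnj (v $$ (k, j))))"
  unfolding mat_diag_mult_right[OF v]
  using assms by (subst mult_mat_index[of _ n n _ n])
    (auto simp: index_mat_adjoint mult_ac intro!: sum.cong)

text \<open>
  Entries are bounded by the operator norm, so the diagonal of \<open>A\<close> is uniformly close to
  that of \<open>c\<close>. This costs a factor of two and makes the approximating diagonal matrix explicit.
\<close>
lemma near_masa_near_diagonal_part:
  assumes A: "A \<in> carrier_mat n n" and c: "c \<in> diag_masa n" and "op_norm (A - c) \<le> e"
  shows "op_norm (A - mat_diag n (\<lambda>i. A $$ (i, i))) \<le> 2 * e"
proof -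
  have cc: "c \<in> carrier_mat n n" using c by (simp add: diag_masa_def)
  let ?D = "mat_diag n (\<lambda>i. A $$ (i, i))"
  have Ac: "A - c \<in> carrier_mat n n" using cc by (rule minus_carrier_mat)
  have "c - ?D = mat_diag n (\<lambda>i. - (A - c) $$ (i, i))"
    using A cc c by (intro eq_matI) (auto simp: diag_masa_def diagonal_mat_def mat_diag_def)
  also have "op_norm \<dots> \<le> e"
    using op_norm_nonneg[OF Ac] cmod_index_le_op_norm[OF Ac] assms(3)
    by (intro op_norm_mat_diag_le) (force simp del: index_minus_mat)+
  finally have "op_norm (c - ?D) \<le> e" .
  then have "op_norm (A - ?D) \<le> e + e" using A cc assms(3) by (intro op_norm_diff_triangle[of A n c]) auto
  then show ?thesis by simp
qed

section \<open>Columns concentrate at one entry\<close>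

locale almost_normalising_isometry =
  fixes n :: nat and \<epsilon> :: real and v :: "complex mat"
  assumes v: "v \<in> carrier_mat n n" and v1: "op_norm v \<le> 1" and eps: "0 < \<epsilon>"
    and normalising: "approx_normalising (diag_masa n) \<epsilon> v"
    and isometry: "approx_partial_isometry \<epsilon> v"
begin

abbreviation "va \<equiv> mat_adjoint v"
abbreviation "p \<equiv> va * v"
abbreviation "g \<equiv> v * va"

definition mass :: "nat \<Rightarrow> real" where "mass j = (\<Sum>i<n. (cmod (v $$ (i, j)))\<^sup>2)"

definition peak :: "nat \<Rightarrow> nat" where
  "peak j = (SOME i. i < n \<and> (\<forall>k<n. cmod (v $$ (k, j)) \<le> cmod (v $$ (i, j))))"

abbreviation "N \<equiv> mat_diag n (\<lambda>j. complex_of_real (mass j))"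

lemma va [simp]: "va \<in> carrier_mat n n" and p [simp]: "p \<in> carrier_mat n n" and g [simp]: "g \<in> carrier_mat n n"
  using v by (auto intro: mult_carrier_mat[of _ n n])

lemma va1: "op_norm va \<le> 1"
  using op_norm_adjoint_le[OF v] v1 by simp

lemma p1: "op_norm p \<le> 1"
  using op_norm_mult[OF va v] mult_mono[OF va1 v1] op_norm_nonneg[OF v] by simp

lemma peak: "j < n \<Longrightarrow> peak j < n" and peak_max: "i < n \<Longrightarrow> cmod (v $$ (i, j)) \<le> cmod (v $$ (peak j, j))"
proof -
  have *: "peak j < n \<and> (\<forall>i<n. cmod (v $$ (i, j)) \<le> cmod (v $$ (peak j, j)))" if "0 < n" for j
  proof -
    let ?S = "(\<lambda>i. cmod (v $$ (i, j))) ` {..<n}"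
    have "Max ?S \<in> ?S" using that by (intro Max_in) auto
    then obtain i where "i < n" "cmod (v $$ (i, j)) = Max ?S" by auto
    then have "i < n \<and> (\<forall>k<n. cmod (v $$ (k, j)) \<le> cmod (v $$ (i, j)))" by auto
    then show ?thesis unfolding peak_def by (rule someI)
  qed
  show "j < n \<Longrightarrow> peak j < n" using *[of j] by auto
  show "i < n \<Longrightarrow> cmod (v $$ (i, j)) \<le> cmod (v $$ (peak j, j))" using *[of j] by auto
qed

lemma mass_eq_vec_norm: "j < n \<Longrightarrow> mass j = (vec_norm (col v j))\<^sup>2"
  using v by (simp add: mass_def vec_norm_sq)

lemma mass_nonneg: "0 \<le> mass j"
  by (simp add: mass_def sum_nonneg)

lemma mass_le_1: "j < n \<Longrightarrow> mass j \<le> 1"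
  using vec_norm_col_le_op_norm[OF v, of j] v1
  by (simp add: mass_eq_vec_norm power_le_one)

lemma peak_le_mass: "j < n \<Longrightarrow> (cmod (v $$ (peak j, j)))\<^sup>2 \<le> mass j"
  unfolding mass_def using peak by (intro member_le_sum) auto

lemma mass_split: "j < n \<Longrightarrow> mass j = (cmod (v $$ (peak j, j)))\<^sup>2 + (\<Sum>i\<in>{..<n} - {peak j}. (cmod (v $$ (i, j)))\<^sup>2)"
  unfolding mass_def using peak by (intro sum.remove) auto

lemma near_diagonal_left:
  assumes "\<And>i. i < n \<Longrightarrow> cmod (f i) \<le> 1"
  shows "op_norm (va * mat_diag n f * v - mat_diag n (\<lambda>j. \<Sum>i<n. f i * complex_of_real ((cmod (v $$ (i, j)))\<^sup>2))) \<le> 2 * \<epsilon>"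
proof -
  let ?A = "va * mat_diag n f * v"
  have "op_norm (mat_diag n f) \<le> 1" using assms by (intro op_norm_mat_diag_le) auto
  then obtain c where "c \<in> diag_masa n" "op_norm (?A - c) \<le> \<epsilon>"
    using normalising mat_diag_in_masa unfolding approx_normalising_def by (meson less_imp_le)
  moreover have "?A \<in> carrier_mat n n"
    using v by (intro mult_carrier_mat[of _ n n]) auto
  ultimately have "op_norm (?A - mat_diag n (\<lambda>j. ?A $$ (j, j))) \<le> 2 * \<epsilon>"
    using near_masa_near_diagonal_part by blast
  moreover have "mat_diag n (\<lambda>j. ?A $$ (j, j)) = mat_diag n (\<lambda>j. \<Sum>i<n. f i * complex_of_real ((cmod (v $$ (i, j)))\<^sup>2))"
    using index_adjoint_diag_mult[OF v, of _ _ f]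
    by (intro eq_matI) (auto simp: complex_norm_square mult_ac simp del: of_real_power)
  ultimately show ?thesis by simp
qed

lemma near_diagonal_right:
  assumes "\<And>i. i < n \<Longrightarrow> cmod (f i) \<le> 1"
  shows "op_norm (v * mat_diag n f * va - mat_diag n (\<lambda>i. (v * mat_diag n f * va) $$ (i, i))) \<le> 2 * \<epsilon>"
proof -
  let ?A = "v * mat_diag n f * va"
  have "op_norm (mat_diag n f) \<le> 1" using assms by (intro op_norm_mat_diag_le) auto
  then obtain c where "c \<in> diag_masa n" "op_norm (?A - c) \<le> \<epsilon>"
    using normalising mat_diag_in_masa unfolding approx_normalising_def by (meson less_imp_le)
  moreover have "?A \<in> carrier_mat n n"
    using v by (intro mult_carrier_mat[of _ n n]) auto
  ultimately show ?thesis using near_masa_near_diagonal_part by blast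
qed

text \<open>
  For \<open>x\<close> the \<open>j\<close>-th column, \<open>v e\<^sub>j\<^sub>j v\<^sup>* = x x\<^sup>*\<close> is within \<open>2\<epsilon>\<close> of its diagonal part. The difference
  maps \<open>x\<close> to the vector with entries \<open>(\<parallel>x\<parallel>\<^sup>2 - |x\<^sub>i|\<^sup>2) x\<^sub>i\<close>, whose norm is at least
  \<open>(\<parallel>x\<parallel>\<^sup>2 - max |x\<^sub>i|\<^sup>2) \<parallel>x\<parallel>\<close>.
\<close>
lemma mass_concentrates:
  assumes j: "j < n"
  shows "mass j - (cmod (v $$ (peak j, j)))\<^sup>2 \<le> 2 * \<epsilon>"
proof (cases "mass j = 0")
  case True
  then show ?thesis using eps by (simp add: order.trans[of _ 0])
next
  case False
  define x where "x = col v j"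
  define f where "f i = (if i = j then 1 else 0 :: complex)" for i
  define A where "A = v * mat_diag n f * va"
  define D where "D = mat_diag n (\<lambda>i. A $$ (i, i))"
  define K where "K = mass j - (cmod (v $$ (peak j, j)))\<^sup>2"
  have x: "x \<in> carrier_vec n" using v carrier_matD(1)[OF v] col_dim[of v j] by (simp add: x_def)
  have xi: "x $ i = v $$ (i, j)" if "i < n" for i using v that j by (simp add: x_def)
  have Aik: "A $$ (i, k) = x $ i * cnj (x $ k)" if "i < n" "k < n" for i k
  proof -
    have "A $$ (i, k) = (\<Sum>l<n. if l = j then x $ i * cnj (x $ k) else 0)"
      unfolding A_def index_mult_diag_adjoint[OF v that]
      by (rule sum.cong) (auto simp: f_def xi that)
    then show ?thesis using j by simp
  qed
  have Ac: "A \<in> carrier_mat n n"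
    unfolding A_def using v by (intro mult_carrier_mat[of _ n n]) auto
  have Dc: "D \<in> carrier_mat n n" by (simp add: D_def)
  have AD: "A - D \<in> carrier_mat n n" using Dc by (rule minus_carrier_mat)
  have "op_norm (A - D) \<le> 2 * \<epsilon>"
    unfolding A_def D_def by (rule near_diagonal_right) (auto simp: f_def)
  then have up: "vec_norm ((A - D) *\<^sub>v x) \<le> 2 * \<epsilon> * vec_norm x"
    using op_norm_mult_mat_vec[OF AD x] vec_norm_nonneg[of x]
    by (meson mult_right_mono order_trans)
  have idx: "((A - D) *\<^sub>v x) $ i = of_real (mass j - (cmod (x $ i))\<^sup>2) * x $ i" if i: "i < n" for i
  proof -
    have "((A - D) *\<^sub>v x) $ i = (\<Sum>k<n. x $ i * (cnj (x $ k) * x $ k) - (if k = i then x $ i * cnj (x $ i) * x $ i else 0))"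
      unfolding mult_mat_vec_index[OF AD x i]
      using i Ac Dc by (intro sum.cong) (auto simp: D_def Aik left_diff_distrib mult_ac)
    also have "\<dots> = x $ i * (\<Sum>k<n. cnj (x $ k) * x $ k) - x $ i * cnj (x $ i) * x $ i"
      using i by (simp add: sum_subtractf sum_distrib_left)
    also have "\<dots> = of_real (mass j) * x $ i - of_real ((cmod (x $ i))\<^sup>2) * x $ i"
      unfolding inner_self[OF x] complex_norm_square using mass_eq_vec_norm[OF j]
      by (simp add: x_def mult_ac)
    finally show ?thesis by (simp add: left_diff_distrib)
  qed
  have K0: "0 \<le> K" using peak_le_mass[OF j] by (simp add: K_def)
  \<comment> \<open>The peak makes \<open>K\<close> the smallest of the factors \<open>\<parallel>x\<parallel>\<^sup>2 - |x\<^sub>i|\<^sup>2\<close>.\<close>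
  have "K * vec_norm x = L2_set (\<lambda>i. K * cmod (x $ i)) {..<n}"
    using K0 x by (simp add: vec_norm_def L2_set_right_distrib)
  also have "\<dots> \<le> L2_set (\<lambda>i. cmod (((A - D) *\<^sub>v x) $ i)) {..<n}"
  proof (rule L2_set_mono)
    fix i assume "i \<in> {..<n}"
    then have i: "i < n" by simp
    have "(cmod (x $ i))\<^sup>2 \<le> (cmod (v $$ (peak j, j)))\<^sup>2"
      using peak_max[OF i, of j] xi[OF i] by (intro power_mono) auto
    then have "K \<le> mass j - (cmod (x $ i))\<^sup>2" by (simp add: K_def)
    then have "K \<le> \<bar>mass j - (cmod (x $ i))\<^sup>2\<bar>" by linarith
    then show "K * cmod (x $ i) \<le> cmod (((A - D) *\<^sub>v x) $ i)"
      unfolding idx[OF i] norm_mult norm_of_real by (rule mult_right_mono) simp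
  qed (use K0 in auto)
  also have "\<dots> = vec_norm ((A - D) *\<^sub>v x)"
    using Ac Dc by (simp add: vec_norm_def)
  finally have "K * vec_norm x \<le> 2 * \<epsilon> * vec_norm x" using up by simp
  moreover have "0 < vec_norm x"
    using False mass_eq_vec_norm[OF j] vec_norm_nonneg[of x] by (auto simp: x_def order_le_less)
  ultimately show ?thesis by (simp add: K_def)
qed

end

section \<open>Intertwining of sign matrices\<close>

context almost_normalising_isometry
begin

lemma p_near_N: "op_norm (p - N) \<le> 2 * \<epsilon>"
  using near_diagonal_left[of "\<lambda>_. 1"] right_mult_one_mat[OF va] by (simp add: mass_def)

text \<open>
  For \<open>r = v - v p\<close> one has \<open>r\<^sup>* r = (p - p\<^sup>2) - p (p - p\<^sup>2)\<close>, which is small because \<open>p\<close> is nearly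
  idempotent; the C*-identity then costs a square root.
\<close>
lemma op_norm_v_minus_vp: "op_norm (v - v * p) \<le> sqrt (2 * \<epsilon>)"
proof -
  define r where "r = v - v * p"
  have vp: "v * p \<in> carrier_mat n n" and pva: "p * va \<in> carrier_mat n n"
    and pp: "p * p \<in> carrier_mat n n"
    using v by (auto intro!: mult_carrier_mat[of _ n n])
  have r: "r \<in> carrier_mat n n" unfolding r_def using vp by (rule minus_carrier_mat)
  have p_self: "mat_adjoint p = p"
    using mat_adjoint_mult[OF va v] by (simp add: mat_adjoint_adjoint[OF v])
  have ra: "mat_adjoint r = va - p * va"
    unfolding r_def mat_adjoint_minus[OF v vp] mat_adjoint_mult[OF v p] p_self ..
  have var: "va * r = p - p * p"
    unfolding r_def mult_minus_distrib_mat[OF va v vp] assoc_mult_mat[OF va v p, symmetric] ..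
  have "mat_adjoint r * r = va * r - p * (va * r)"
    unfolding ra minus_mult_distrib_mat[OF va pva r] assoc_mult_mat[OF p va r] ..
  then have rr: "mat_adjoint r * r = (p - p * p) - p * (p - p * p)" unfolding var .
  have q: "p - p * p \<in> carrier_mat n n" using pp by (rule minus_carrier_mat)
  have qe: "op_norm (p - p * p) \<le> \<epsilon>"
    using isometry by (simp add: approx_partial_isometry_def)
  have "op_norm (p * (p - p * p)) \<le> 1 * \<epsilon>"
    using op_norm_mult[OF p q] mult_mono[OF p1 qe] op_norm_nonneg[OF q] by auto
  then have "op_norm (mat_adjoint r * r) \<le> \<epsilon> + \<epsilon>"
    unfolding rr using op_norm_diff_le[OF q mult_carrier_mat[OF p q]] qe by linarith
  then have "(op_norm r)\<^sup>2 \<le> 2 * \<epsilon>" using op_norm_sq_le[OF r] by simp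
  then show ?thesis unfolding r_def using real_le_rsqrt by blast
qed

text \<open>
  The matrix \<open>v\<^sup>* d v\<close> is close to \<open>p S\<close>, where \<open>S\<close> transports the signs of \<open>d\<close> from rows to columns
  along \<open>peak\<close>. The leading \<open>v\<^sup>*\<close> is removed by multiplying with \<open>v\<close>: on the left hand side
  \<open>v v\<^sup>*\<close> passes through \<open>d\<close>, being nearly diagonal, and \<open>v p\<close> is close to \<open>v\<close>.
\<close>
lemma sign_intertwining:
  assumes f: "\<And>i. f i = 1 \<or> f i = (-1 :: complex)"
  shows "op_norm (v - mat_diag n f * v * mat_diag n (\<lambda>j. f (peak j))) \<le> 12 * \<epsilon> + 2 * sqrt (2 * \<epsilon>)"
proof -
  define d where "d = mat_diag n f"
  define S where "S = mat_diag n (\<lambda>j. f (peak j))"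
  define D where "D = mat_diag n (\<lambda>j. \<Sum>i<n. f i * complex_of_real ((cmod (v $$ (i, j)))\<^sup>2))"
  define N' where "N' = mat_diag n (\<lambda>i. g $$ (i, i))"
  have f1: "cmod (f i) \<le> 1" and ff: "f i * f i = 1" for i using f[of i] by auto
  have c [simp]: "d \<in> carrier_mat n n" "S \<in> carrier_mat n n" "D \<in> carrier_mat n n"
    "N' \<in> carrier_mat n n" "N \<in> carrier_mat n n"
    by (simp_all add: d_def S_def D_def N'_def)
  have m [simp]: "A * B \<in> carrier_mat n n" if "A \<in> carrier_mat n n" "B \<in> carrier_mat n n"
    for A B :: "complex mat" using that by simp
  note [simp] = v
  have d1: "op_norm d \<le> 1" and S1: "op_norm S \<le> 1"
    unfolding d_def S_def using f1 by (auto intro: op_norm_mat_diag_le)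
  have assoc: "A * B * C = A * (B * C)"
    if "A \<in> carrier_mat n n" "B \<in> carrier_mat n n" "C \<in> carrier_mat n n" for A B C :: "complex mat"
    using that by (rule assoc_mult_mat)
  have 1: "op_norm (va * d * v - D) \<le> 2 * \<epsilon>"
    unfolding d_def D_def by (rule near_diagonal_left) (rule f1)
  \<comment> \<open>In each column the sign at the peak may replace all other signs, because they carry
      mass at most \<open>2\<epsilon>\<close>.\<close>
  have 2: "op_norm (D - N * S) \<le> 4 * \<epsilon>"
  proof -
    have "D - N * S = mat_diag n (\<lambda>j. \<Sum>i<n. (f i - f (peak j)) * complex_of_real ((cmod (v $$ (i, j)))\<^sup>2))"
      unfolding D_def S_def mat_diag_diag
      by (intro eq_matI) (auto simp: mat_diag_def mass_def left_diff_distrib sum_subtractf sum_distrib_left mult_ac)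
    also have "op_norm \<dots> \<le> 4 * \<epsilon>"
    proof (rule op_norm_mat_diag_le)
      fix j assume j: "j < n"
      have "(\<Sum>i<n. (f i - f (peak j)) * complex_of_real ((cmod (v $$ (i, j)))\<^sup>2))
          = (\<Sum>i\<in>{..<n} - {peak j}. (f i - f (peak j)) * complex_of_real ((cmod (v $$ (i, j)))\<^sup>2))"
        using peak[OF j] by (subst sum.remove[of _ "peak j"]) auto
      also have "cmod \<dots> \<le> (\<Sum>i\<in>{..<n} - {peak j}. 2 * (cmod (v $$ (i, j)))\<^sup>2)"
      proof (rule order_trans[OF norm_sum sum_mono])
        fix i
        have "cmod (f i - f (peak j)) \<le> 2" using f[of i] f[of "peak j"] by auto
        then show "cmod ((f i - f (peak j)) * complex_of_real ((cmod (v $$ (i, j)))\<^sup>2)) \<le> 2 * (cmod (v $$ (i, j)))\<^sup>2"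
          unfolding norm_mult norm_of_real by (intro mult_mono) auto
      qed
      also have "\<dots> = 2 * (mass j - (cmod (v $$ (peak j, j)))\<^sup>2)"
        using mass_split[OF j] by (simp add: sum_distrib_left)
      also have "\<dots> \<le> 4 * \<epsilon>" using mass_concentrates[OF j] by simp
      finally show "cmod (\<Sum>i<n. (f i - f (peak j)) * complex_of_real ((cmod (v $$ (i, j)))\<^sup>2)) \<le> 4 * \<epsilon>" .
    qed (use eps in simp)
    finally show ?thesis .
  qed
  have 3: "op_norm (N * S - p * S) \<le> 2 * \<epsilon>"
    using p_near_N op_norm_minus_commute[of p n N] S1 by (intro op_norm_mult_diff_right[where n = n]) simp_all
  have "op_norm (va * d * v - p * S) \<le> (2 * \<epsilon> + 4 * \<epsilon>) + 2 * \<epsilon>"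
    using 1 2 3 by (intro op_norm_diff_triangle[of "va * d * v" n "N * S" "p * S"]
      op_norm_diff_triangle[of "va * d * v" n D "N * S"]) simp_all
  then have 4: "op_norm (v * (va * d * v) - v * (p * S)) \<le> 8 * \<epsilon>"
    using v1 by (intro op_norm_mult_diff_left[where n = n]) simp_all
  have g_N': "op_norm (g - N') \<le> 2 * \<epsilon>"
    using near_diagonal_right[of "\<lambda>_. 1"] right_mult_one_mat[OF v] by (simp add: N'_def)
  have dN': "N' * d = d * N'"
    unfolding d_def N'_def mat_diag_diag by (simp add: mult.commute)
  have "op_norm (d * g - d * N') \<le> 2 * \<epsilon>"
    using g_N' d1 by (intro op_norm_mult_diff_left[where n = n]) simp_all
  moreover have "op_norm (d * N' - g * d) \<le> 2 * \<epsilon>"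
    unfolding dN'[symmetric] using g_N' d1 op_norm_minus_commute[of g n N']
    by (intro op_norm_mult_diff_right[where n = n]) simp_all
  ultimately have "op_norm (d * g - g * d) \<le> 2 * \<epsilon> + 2 * \<epsilon>"
    by (intro op_norm_diff_triangle[of _ n "d * N'"]) simp_all
  then have 5: "op_norm (d * g * v - g * d * v) \<le> 4 * \<epsilon>"
    using v1 by (intro op_norm_mult_diff_right[where n = n]) simp_all
  \<comment> \<open>By associativity the two estimates meet at \<open>v v\<^sup>* d v\<close>.\<close>
  have "d * g * v = d * (v * p)" "g * d * v = v * (va * d * v)" "v * (p * S) = v * p * S"
    by (simp_all add: assoc)
  then have 6: "op_norm (d * (v * p) - v * p * S) \<le> 4 * \<epsilon> + 8 * \<epsilon>"
    using 4 5 by (intro op_norm_diff_triangle[of _ n "v * (va * d * v)"]) simp_all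
  have "op_norm (d * v - d * (v * p)) \<le> sqrt (2 * \<epsilon>)"
    using op_norm_v_minus_vp d1 by (intro op_norm_mult_diff_left[where n = n]) simp_all
  moreover have "op_norm (v * p * S - v * S) \<le> sqrt (2 * \<epsilon>)"
    using op_norm_v_minus_vp S1 op_norm_minus_commute[of "v * p" n v]
    by (intro op_norm_mult_diff_right[where n = n]) simp_all
  moreover from 6 have "op_norm (d * (v * p) - v * p * S) \<le> 12 * \<epsilon>" by simp
  ultimately have "op_norm (d * v - v * S) \<le> sqrt (2 * \<epsilon>) + (12 * \<epsilon> + sqrt (2 * \<epsilon>))"
    by (intro op_norm_diff_triangle[of "d * v" n "d * (v * p)"]
        op_norm_diff_triangle[of "d * (v * p)" n "v * p * S"]) simp_all
  then have "op_norm (v * S * S - d * v * S) \<le> 12 * \<epsilon> + 2 * sqrt (2 * \<epsilon>)"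
    using op_norm_minus_commute[of "d * v" n "v * S"] S1
    by (intro op_norm_mult_diff_right[where n = n]) simp_all
  \<comment> \<open>Signs square to one, so a further factor \<open>S\<close> turns \<open>d v \<approx> v S\<close> into \<open>d v S \<approx> v\<close>.\<close>
  moreover have "v * S * S = v"
    using right_mult_one_mat[OF v] by (simp add: assoc) (simp add: S_def ff)
  ultimately show ?thesis by (simp add: d_def S_def)
qed

end

section \<open>Averaging over signs\<close>

definition sign_on :: "nat set \<Rightarrow> nat \<Rightarrow> complex" where
  "sign_on A i = (if i \<in> A then 1 else -1)"

text \<open>
  Orthogonality of the coordinate characters of the group of sign vectors: flipping the sign at
  \<open>i\<close> is an involution that changes the sign of every summand.
\<close>
lemma sum_sign_on_eq_0:
  assumes "i < n" "i \<noteq> k"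
  shows "(\<Sum>A\<in>Pow {..<n}. sign_on A i * sign_on A k) = 0"
proof -
  define flip where "flip A = (if i \<in> A then A - {i} else insert i A)" for A
  have "(\<Sum>A\<in>Pow {..<n}. sign_on A i * sign_on A k) = (\<Sum>A\<in>Pow {..<n}. - (sign_on A i * sign_on A k))"
    by (rule sum.reindex_bij_witness[of _ flip flip])
      (use assms in \<open>auto simp: flip_def sign_on_def\<close>)
  then show ?thesis by (simp add: sum_negf)
qed

text \<open>
  The \<open>(i, j)\<close> entry of \<open>d v s\<close> is \<open>d\<^sub>i d\<^bsub>\<sigma>(j)\<^esub> v\<^sub>i\<^sub>j\<close>, so the mean over all signs retains exactly
  the entries on the graph of \<open>\<sigma>\<close>, and the norm of a mean is at most the mean of the norms.
\<close>
lemma op_norm_sign_average: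
  fixes v :: "complex mat"
  assumes v: "v \<in> carrier_mat n n" and \<sigma>: "\<And>j. j < n \<Longrightarrow> \<sigma> j < n"
    and bound: "\<And>f. (\<And>i. f i = 1 \<or> f i = -1) \<Longrightarrow> op_norm (v - mat_diag n f * v * mat_diag n (\<lambda>j. f (\<sigma> j))) \<le> K"
  shows "op_norm (v - mat n n (\<lambda>(i, j). if i = \<sigma> j then v $$ (i, j) else 0)) \<le> K"
proof -
  define F where "F = Pow {..<n}"
  define G where "G A = v - mat_diag n (sign_on A) * v * mat_diag n (\<lambda>j. sign_on A (\<sigma> j))" for A
  have card: "card F = 2 ^ n" and fin: "finite F" by (simp_all add: F_def card_Pow)
  have c: "mat_diag n (sign_on A) * v * mat_diag n (\<lambda>j. sign_on A (\<sigma> j)) \<in> carrier_mat n n" for A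
    using v by (intro mult_carrier_mat[of _ n n]) auto
  have G: "G A \<in> carrier_mat n n" for A
    unfolding G_def by (rule minus_carrier_mat[OF c])
  have Gij: "G A $$ (i, j) = v $$ (i, j) - sign_on A i * sign_on A (\<sigma> j) * v $$ (i, j)"
    if "i < n" "j < n" for A i j
    using that v unfolding G_def mat_diag_mult_left[OF v]
    by (subst mat_diag_mult_right[of _ n]) (auto simp: mult_ac)
  have "v - mat n n (\<lambda>(i, j). if i = \<sigma> j then v $$ (i, j) else 0)
      = (1 / 2 ^ n) \<cdot>\<^sub>m mat n n (\<lambda>ij. \<Sum>A\<in>F. G A $$ ij)"
  proof (rule eq_matI)
    fix i j assume "i < dim_row ((1 / 2 ^ n) \<cdot>\<^sub>m mat n n (\<lambda>ij. \<Sum>A\<in>F. G A $$ ij))"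
      "j < dim_col ((1 / 2 ^ n) \<cdot>\<^sub>m mat n n (\<lambda>ij. \<Sum>A\<in>F. G A $$ ij))"
    then have ij: "i < n" "j < n" by simp_all
    have "(\<Sum>A\<in>F. G A $$ (i, j)) = 2 ^ n * v $$ (i, j) - (\<Sum>A\<in>F. sign_on A i * sign_on A (\<sigma> j)) * v $$ (i, j)"
      by (simp add: Gij[OF ij] sum_subtractf card sum_distrib_right)
    moreover have "(\<Sum>A\<in>F. sign_on A i * sign_on A (\<sigma> j)) = (if i = \<sigma> j then 2 ^ n else 0)"
    proof (cases "i = \<sigma> j")
      case True
      then have "(\<Sum>A\<in>F. sign_on A i * sign_on A (\<sigma> j)) = (\<Sum>A\<in>F. 1)"
        by (intro sum.cong) (auto simp: sign_on_def)
      then show ?thesis using True by (simp add: card)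
    qed (use sum_sign_on_eq_0 ij F_def in simp)
    ultimately show "(v - mat n n (\<lambda>(i, j). if i = \<sigma> j then v $$ (i, j) else 0)) $$ (i, j)
      = ((1 / 2 ^ n) \<cdot>\<^sub>m mat n n (\<lambda>ij. \<Sum>A\<in>F. G A $$ ij)) $$ (i, j)"
      using v ij by simp
  qed (use v in auto)
  also have "op_norm \<dots> \<le> cmod (1 / 2 ^ n) * op_norm (mat n n (\<lambda>ij. \<Sum>A\<in>F. G A $$ ij))"
    by (rule op_norm_smult[of _ n]) simp
  also have "\<dots> \<le> cmod (1 / 2 ^ n) * (\<Sum>A\<in>F. op_norm (G A))"
    by (intro mult_left_mono op_norm_sum fin G) simp
  also have "\<dots> \<le> cmod (1 / 2 ^ n) * (\<Sum>A\<in>F. K)"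
    unfolding G_def by (intro mult_left_mono sum_mono bound) (auto simp: sign_on_def)
  also have "\<dots> = K" by (simp add: card norm_divide norm_power)
  finally show ?thesis .
qed

section \<open>Matrices supported on a partial matching\<close>

definition partial_matching :: "nat \<Rightarrow> complex mat \<Rightarrow> bool" where
  "partial_matching n M \<longleftrightarrow> M \<in> carrier_mat n n \<and>
     (\<forall>i<n. \<forall>j<n. \<forall>k<n. M $$ (i, j) \<noteq> 0 \<longrightarrow> M $$ (i, k) \<noteq> 0 \<longrightarrow> j = k) \<and>
     (\<forall>i<n. \<forall>j<n. \<forall>k<n. M $$ (j, i) \<noteq> 0 \<longrightarrow> M $$ (k, i) \<noteq> 0 \<longrightarrow> j = k)"

text \<open>
  An off-diagonal entry \<open>(j, k)\<close> is a sum of products of two entries of \<open>M\<close> from the same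
  row and different columns, and one of the two always vanishes.
\<close>
lemma partial_matching_adjoint_diag_mult:
  assumes "partial_matching n M"
  shows "mat_adjoint M * mat_diag n f * M =
    mat_diag n (\<lambda>j. \<Sum>i<n. f i * complex_of_real ((cmod (M $$ (i, j)))\<^sup>2))"
    (is "?A = ?D")
proof (rule eq_matI)
  have M: "M \<in> carrier_mat n n" using assms by (simp add: partial_matching_def)
  show "dim_row ?A = dim_row ?D"
    using carrier_matD[OF mat_adjoint_carrier[OF M]] by simp
  show "dim_col ?A = dim_col ?D"
    using M by simp
  fix j k assume "j < dim_row ?D"
    "k < dim_col ?D"
  then have jk: "j < n" "k < n" by simp_all
  show "?A $$ (j, k) = ?D $$ (j, k)"
  proof (cases "j = k")
    case True
    then show ?thesis using jk index_adjoint_diag_mult[OF M jk, of f]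
      by (simp add: complex_norm_square mult_ac del: of_real_power)
  next
    case False
    then have "f i * (cnj (M $$ (i, j)) * M $$ (i, k)) = 0" if "i < n" for i
      using that jk assms by (auto simp: partial_matching_def)
    then have "(\<Sum>i<n. f i * (cnj (M $$ (i, j)) * M $$ (i, k))) = 0"
      by (intro sum.neutral ballI) (simp only: lessThan_iff)
    then show ?thesis using False jk index_adjoint_diag_mult[OF M jk, of f] by simp
  qed
qed

lemma partial_matching_adjoint:
  assumes "partial_matching n M"
  shows "partial_matching n (mat_adjoint M)"
proof -
  have M: "M \<in> carrier_mat n n" using assms by (simp add: partial_matching_def)
  have "mat_adjoint M $$ (i, j) \<noteq> 0 \<longleftrightarrow> M $$ (j, i) \<noteq> 0" if "i < n" "j < n" for i j
    using index_mat_adjoint[OF M that] by simp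
  then show ?thesis
    using assms mat_adjoint_carrier[OF M] unfolding partial_matching_def by simp
qed

text \<open>
  The sum has at most one nonzero term. It is stated for a predicate so that it serves both
  upper bounds and the property of being \<open>0\<close> or \<open>1\<close>.
\<close>
lemma partial_matching_col_sum:
  assumes M: "partial_matching n M" and j: "j < n"
    and entries: "\<And>i. i < n \<Longrightarrow> M $$ (i, j) \<noteq> 0 \<Longrightarrow> P ((cmod (M $$ (i, j)))\<^sup>2)" and "P 0"
  shows "P (\<Sum>i<n. (cmod (M $$ (i, j)))\<^sup>2)"
proof (cases "\<exists>i<n. M $$ (i, j) \<noteq> 0")
  case True
  then obtain i where i: "i < n" "M $$ (i, j) \<noteq> 0" by blast
  have "M $$ (k, j) = 0" if "k < n" "k \<noteq> i" for k
  proof (rule ccontr)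
    assume "M $$ (k, j) \<noteq> 0"
    moreover have "\<forall>i<n. \<forall>k<n. M $$ (i, j) \<noteq> 0 \<longrightarrow> M $$ (k, j) \<noteq> 0 \<longrightarrow> i = k"
      using M j unfolding partial_matching_def by simp
    ultimately show False using i that by simp
  qed
  then have "(\<Sum>k<n. (cmod (M $$ (k, j)))\<^sup>2) = (\<Sum>k<n. if k = i then (cmod (M $$ (i, j)))\<^sup>2 else 0)"
    by (intro sum.cong) auto
  then show ?thesis using entries[OF i] i by simp
next
  case False
  then have "(\<Sum>i<n. (cmod (M $$ (i, j)))\<^sup>2) = 0" by (intro sum.neutral) auto
  then show ?thesis using \<open>P 0\<close> by simp
qed

lemma partial_matching_gram:
  assumes "partial_matching n M"
  shows "mat_adjoint M * M = mat_diag n (\<lambda>j. complex_of_real (\<Sum>i<n. (cmod (M $$ (i, j)))\<^sup>2))"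
proof -
  have "M \<in> carrier_mat n n" using assms by (simp add: partial_matching_def)
  from right_mult_one_mat[OF mat_adjoint_carrier[OF this]]
  show ?thesis using partial_matching_adjoint_diag_mult[OF assms, of "\<lambda>_. 1"] by simp
qed

text \<open>
  On a partial matching, and unlike for general matrices, entrywise control is operator norm
  control: \<open>M\<^sup>* M\<close> is diagonal with at most one squared modulus in each place.
\<close>
lemma op_norm_partial_matching_le:
  assumes M: "partial_matching n M" and "0 \<le> K"
    and entries: "\<And>i j. i < n \<Longrightarrow> j < n \<Longrightarrow> cmod (M $$ (i, j)) \<le> K"
  shows "op_norm M \<le> K"
proof -
  have "op_norm (mat_adjoint M * M) \<le> K\<^sup>2"
    unfolding partial_matching_gram[OF M]
  proof (rule op_norm_mat_diag_le)
    fix j assume j: "j < n"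
    have "(\<Sum>i<n. (cmod (M $$ (i, j)))\<^sup>2) \<le> K\<^sup>2"
      by (rule partial_matching_col_sum[OF M j]) (use entries j in \<open>auto intro: power_mono\<close>)
    then show "cmod (complex_of_real (\<Sum>i<n. (cmod (M $$ (i, j)))\<^sup>2)) \<le> K\<^sup>2"
      unfolding norm_of_real by (simp add: sum_nonneg)
  qed simp
  then have "(op_norm M)\<^sup>2 \<le> K\<^sup>2"
    using op_norm_sq_le[of M n] M by (simp add: partial_matching_def)
  then show ?thesis using \<open>0 \<le> K\<close> by (rule power2_le_imp_le)
qed

lemma partial_matching_in_normaliser:
  assumes M: "partial_matching n M" and "M \<in> \<A>"
    and entries: "\<And>i j. i < n \<Longrightarrow> j < n \<Longrightarrow> M $$ (i, j) \<noteq> 0 \<Longrightarrow> cmod (M $$ (i, j)) = 1"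
  shows "M \<in> normaliser (diag_masa n) \<A>"
proof -
  have Mc: "M \<in> carrier_mat n n" using M by (simp add: partial_matching_def)
  define s where "s j = (\<Sum>i<n. (cmod (M $$ (i, j)))\<^sup>2)" for j
  have s: "s j * s j = s j" if "j < n" for j
    unfolding s_def by (rule partial_matching_col_sum[OF M that]) (use entries that in auto)
  have gram: "mat_adjoint M * M = mat_diag n (\<lambda>j. complex_of_real (s j))"
    unfolding s_def by (rule partial_matching_gram[OF M])
  have self: "mat_adjoint (mat_diag n (\<lambda>j. complex_of_real (s j))) = mat_diag n (\<lambda>j. complex_of_real (s j))"
    by (simp add: mat_adjoint_mat_diag)
  have idem: "mat_diag n (\<lambda>j. complex_of_real (s j)) * mat_diag n (\<lambda>j. complex_of_real (s j)) = mat_diag n (\<lambda>j. complex_of_real (s j))"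
    unfolding mat_diag_diag by (rule eq_matI) (auto simp: s simp flip: of_real_mult)
  have "partial_isometry M"
    unfolding partial_isometry_def projection_mat_def gram using self idem by blast
  moreover have "mat_adjoint M * c * M \<in> diag_masa n" if "c \<in> diag_masa n" for c
    by (subst masa_eq_mat_diag[OF that])
      (simp only: partial_matching_adjoint_diag_mult[OF M] mat_diag_in_masa)
  moreover have "M * c * mat_adjoint M \<in> diag_masa n" if "c \<in> diag_masa n" for c
    by (subst masa_eq_mat_diag[OF that])
      (simp only: partial_matching_adjoint_diag_mult[OF partial_matching_adjoint[OF M],
          unfolded mat_adjoint_adjoint[OF Mc]] mat_diag_in_masa)
  ultimately show ?thesis using \<open>M \<in> \<A>\<close> by (simp add: normaliser_def)
qed

section \<open>Rounding to a partial isometry\<close>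

context almost_normalising_isometry
begin

definition dominant :: "complex mat" where
  "dominant = mat n n (\<lambda>(i, j). if i = peak j then v $$ (i, j) else 0)"

text \<open>
  The peak of each column has modulus near \<open>0\<close> or near \<open>1\<close>; the threshold separates the two cases.
  It is large enough that no row can contain two entries above it when \<open>\<epsilon> \<le> 1/8\<close>.
\<close>
definition rounding :: "complex mat" where
  "rounding = mat n n (\<lambda>(i, j). if i = peak j \<and> 1 / 2 < cmod (v $$ (i, j))
     then v $$ (i, j) / complex_of_real (cmod (v $$ (i, j))) else 0)"

lemma dominant_near: "op_norm (v - dominant) \<le> 12 * \<epsilon> + 2 * sqrt (2 * \<epsilon>)"
  unfolding dominant_def
proof (rule op_norm_sign_average[OF v])
  show "j < n \<Longrightarrow> peak j < n" for j by (rule peak)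
  show "op_norm (v - mat_diag n f * v * mat_diag n (\<lambda>j. f (peak j))) \<le> 12 * \<epsilon> + 2 * sqrt (2 * \<epsilon>)"
    if "\<And>i. f i = 1 \<or> f i = -1" for f
    using that by (rule sign_intertwining)
qed

text \<open>
  The numbers \<open>t\<^sub>j\<close> are the diagonal of \<open>p\<close>. Since \<open>p\<close> is close to its diagonal part \<open>N\<close>, the
  diagonal of \<open>p\<^sup>2\<close> is close to that of \<open>p N\<close>, which is \<open>t\<^sub>j\<^sup>2\<close>.
\<close>
lemma mass_almost_idempotent:
  assumes j: "j < n"
  shows "mass j * (1 - mass j) \<le> 3 * \<epsilon>"
proof -
  have pp: "p * p \<in> carrier_mat n n" and pN: "p * N \<in> carrier_mat n n"
    using mult_carrier_mat[OF p p] mult_carrier_mat[OF p mat_diag_dim] by simp_all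
  have q1: "p - p * p \<in> carrier_mat n n" and q2: "p * p - p * N \<in> carrier_mat n n"
    using pp pN by (auto intro: minus_carrier_mat)
  have "cmod ((p - p * p) $$ (j, j)) \<le> \<epsilon>"
    using cmod_index_le_op_norm[OF q1 j j] isometry by (simp only: approx_partial_isometry_def)
  moreover have "op_norm (p * p - p * N) \<le> 2 * \<epsilon>"
    using p_near_N p1 by (intro op_norm_mult_diff_left[where n = n] p mat_diag_dim) simp_all
  then have "cmod ((p * p - p * N) $$ (j, j)) \<le> 2 * \<epsilon>"
    using cmod_index_le_op_norm[OF q2 j j] by linarith
  ultimately have *: "cmod ((p - p * p) $$ (j, j) + (p * p - p * N) $$ (j, j)) \<le> 3 * \<epsilon>"
    using norm_triangle_ineq[of "(p - p * p) $$ (j, j)" "(p * p - p * N) $$ (j, j)"] by linarith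
  have pjj: "p $$ (j, j) = complex_of_real (mass j)"
    using mult_mat_index[OF va v j j] j
    by (simp add: index_mat_adjoint[OF v] mass_def complex_norm_square mult.commute del: of_real_power)
  have "(p * N) $$ (j, j) = complex_of_real (mass j) * complex_of_real (mass j)"
    unfolding mat_diag_mult_right[OF p] using j pjj by simp
  then have "(p - p * p) $$ (j, j) + (p * p - p * N) $$ (j, j) = complex_of_real (mass j * (1 - mass j))"
    using pjj carrier_matD[OF p] carrier_matD[OF pp] carrier_matD[OF pN] j
    by (simp add: algebra_simps del: index_mult_mat(1))
  then show ?thesis using * by (metis norm_of_real abs_le_D1)
qed

text \<open>
  A dominant entry of modulus above \<open>1/2\<close> forces \<open>t\<^sub>j \<ge> 1/4\<close>, so near idempotence gives
  \<open>1 - t\<^sub>j \<le> 12\<epsilon>\<close>; another \<open>2\<epsilon>\<close> is lost to the other entries of the column.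
\<close>
lemma peak_large:
  assumes j: "j < n" and "\<epsilon> \<le> 1 / 8" and large: "1 / 2 < cmod (v $$ (peak j, j))"
  shows "1 - cmod (v $$ (peak j, j)) \<le> 14 * \<epsilon>" "cmod (v $$ (peak j, j)) \<le> 1"
proof -
  let ?M = "cmod (v $$ (peak j, j))"
  show M1: "?M \<le> 1" using cmod_index_le_op_norm[OF v peak[OF j] j] v1 by simp
  have "(1 / 2)\<^sup>2 \<le> ?M\<^sup>2" using large by (intro power_mono) auto
  then have "1 / 4 \<le> mass j" using peak_le_mass[OF j] by (simp add: power2_eq_square)
  then have "1 / 4 * (1 - mass j) \<le> mass j * (1 - mass j)"
    using mass_le_1[OF j] by (intro mult_right_mono) auto
  then have "1 - mass j \<le> 12 * \<epsilon>" using mass_almost_idempotent[OF j] by simp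
  moreover have "?M\<^sup>2 \<le> ?M" using M1 by (simp add: power2_eq_square mult_left_le)
  ultimately show "1 - ?M \<le> 14 * \<epsilon>" using mass_concentrates[OF j] by simp
qed

text \<open>
  By concentration \<open>t\<^sub>j \<le> 1/4 + 2\<epsilon> \<le> 1/2\<close>, which selects the root near \<open>0\<close> of the almost
  idempotence relation.
\<close>
lemma mass_small:
  assumes j: "j < n" and "\<epsilon> \<le> 1 / 8" and small: "cmod (v $$ (peak j, j)) \<le> 1 / 2"
  shows "mass j \<le> 6 * \<epsilon>"
proof -
  have "(cmod (v $$ (peak j, j)))\<^sup>2 \<le> (1 / 2)\<^sup>2" using small by (intro power_mono) auto
  then have "mass j \<le> 1 / 2"
    using mass_concentrates[OF j] assms(2) by (simp add: power2_eq_square)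
  then have "mass j * (1 / 2) \<le> mass j * (1 - mass j)"
    using mass_nonneg by (intro mult_left_mono) auto
  then show ?thesis using mass_almost_idempotent[OF j] by simp
qed

text \<open>
  Columns contain at most one nonzero entry by construction. For rows: the \<open>(j, k)\<close> entry of
  \<open>v\<^sup>* e\<^sub>i\<^sub>i v\<close> has modulus \<open>|v\<^sub>i\<^sub>j| |v\<^sub>i\<^sub>k|\<close> and is at most \<open>2\<epsilon> \<le> 1/4\<close> off the diagonal, so two
  entries of one row cannot both exceed \<open>1/2\<close>.
\<close>
lemma rounding_matching:
  assumes "\<epsilon> \<le> 1 / 8"
  shows "partial_matching n rounding"
proof -
  have "j = k" if i: "i < n" "j < n" "k < n" "1 / 2 < cmod (v $$ (i, j))" "1 / 2 < cmod (v $$ (i, k))" for i j k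
  proof (rule ccontr)
    assume "j \<noteq> k"
    define f where "f l = (if l = i then 1 else 0 :: complex)" for l
    define D where "D = mat_diag n (\<lambda>j. \<Sum>i<n. f i * complex_of_real ((cmod (v $$ (i, j)))\<^sup>2))"
    let ?A = "va * mat_diag n f * v"
    have AD: "?A - D \<in> carrier_mat n n" by (rule minus_carrier_mat) (simp add: D_def)
    have "?A $$ (j, k) = (\<Sum>l<n. if l = i then cnj (v $$ (i, j)) * v $$ (i, k) else 0)"
      unfolding index_adjoint_diag_mult[OF v i(2,3)] by (rule sum.cong) (auto simp: f_def)
    then have "?A $$ (j, k) = cnj (v $$ (i, j)) * v $$ (i, k)" using i by simp
    then have "(?A - D) $$ (j, k) = cnj (v $$ (i, j)) * v $$ (i, k)"
      using i \<open>j \<noteq> k\<close> by (simp add: D_def del: index_mult_mat(1))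
    then have "cmod (v $$ (i, j)) * cmod (v $$ (i, k)) \<le> op_norm (?A - D)"
      using cmod_index_le_op_norm[OF AD i(2,3)] by (simp add: norm_mult)
    also have "\<dots> \<le> 2 * \<epsilon>"
      unfolding D_def by (rule near_diagonal_left) (simp add: f_def)
    also have "\<dots> \<le> 1 / 2 * (1 / 2)" using assms by simp
    also have "\<dots> < cmod (v $$ (i, j)) * cmod (v $$ (i, k))"
      using i by (intro mult_strict_mono) auto
    finally show False by simp
  qed
  then show ?thesis unfolding partial_matching_def rounding_def by (auto split: if_splits)
qed

text \<open>
  With \<open>w\<close> the dominant part, \<open>q\<close> the projection onto the columns whose peak is at most \<open>1/2\<close> and
  \<open>q' = 1 - q\<close>, the distance is split along \<open>rounding\<close>, \<open>w q'\<close>, \<open>v q'\<close>, \<open>v\<close>. The first step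
  lives on a partial matching, where only entries matter. The columns of \<open>w\<close> in \<open>q\<close> may share
  rows, so they cannot be treated entrywise; instead \<open>v q\<close> is bounded through
  \<open>(v q)\<^sup>* (v q) = q p q\<close>, which is close to a small diagonal matrix.
\<close>
lemma rounding_near:
  assumes e: "\<epsilon> \<le> 1 / 8"
  shows "op_norm (rounding - v) \<le> 26 * \<epsilon> + 2 * sqrt (2 * \<epsilon>) + sqrt (8 * \<epsilon>)"
proof -
  define small where "small j = (if cmod (v $$ (peak j, j)) \<le> 1 / 2 then 1 else 0 :: complex)" for j
  define q where "q = mat_diag n small"
  define q' where "q' = mat_diag n (\<lambda>j. 1 - small j)"
  have q: "q \<in> carrier_mat n n" "q' \<in> carrier_mat n n" by (simp_all add: q_def q'_def)
  have q1: "op_norm q \<le> 1" "op_norm q' \<le> 1"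
    unfolding q_def q'_def by (auto intro!: op_norm_mat_diag_le simp: small_def)
  have w: "dominant \<in> carrier_mat n n" and r: "rounding \<in> carrier_mat n n"
    by (simp_all add: dominant_def rounding_def)
  have wq: "dominant * q' \<in> carrier_mat n n" and vq': "v * q' \<in> carrier_mat n n"
    and vq: "v * q \<in> carrier_mat n n"
    using w v q by (auto intro!: mult_carrier_mat[of _ n n])
  have 1: "op_norm (rounding - dominant * q') \<le> 14 * \<epsilon>"
  proof (rule op_norm_partial_matching_le)
    have entry: "(rounding - dominant * q') $$ (i, j) =
      (if i = peak j \<and> 1 / 2 < cmod (v $$ (i, j))
       then rounding $$ (i, j) * complex_of_real (1 - cmod (v $$ (i, j))) else 0)"
      if "i < n" "j < n" for i j
      using that unfolding q'_def mat_diag_mult_right[OF w]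
      by (auto simp: dominant_def rounding_def small_def field_simps)
    have "rounding - dominant * q' \<in> carrier_mat n n" using wq by (rule minus_carrier_mat)
    then show "partial_matching n (rounding - dominant * q')"
      using rounding_matching[OF e] entry unfolding partial_matching_def
      by (auto simp del: index_minus_mat(1) index_mult_mat(1) split: if_splits)
    show "cmod ((rounding - dominant * q') $$ (i, j)) \<le> 14 * \<epsilon>" if ij: "i < n" "j < n" for i j
    proof (cases "i = peak j \<and> 1 / 2 < cmod (v $$ (i, j))")
      case True
      have "rounding $$ (i, j) = (if i = peak j \<and> 1 / 2 < cmod (v $$ (i, j))
          then v $$ (i, j) / complex_of_real (cmod (v $$ (i, j))) else 0)"
        using ij by (simp add: rounding_def)
      also have "\<dots> = v $$ (i, j) / complex_of_real (cmod (v $$ (i, j)))"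
        using True by (rule if_P)
      finally have "rounding $$ (i, j) = v $$ (i, j) / complex_of_real (cmod (v $$ (i, j)))" .
      moreover have "v $$ (i, j) \<noteq> 0" using True by auto
      ultimately have "cmod (rounding $$ (i, j)) = 1" by (simp add: norm_divide)
      moreover have "\<bar>1 - cmod (v $$ (i, j))\<bar> \<le> 14 * \<epsilon>" using peak_large[OF ij(2) e] True by auto
      ultimately show ?thesis unfolding entry[OF ij] using True
        by (simp add: norm_mult del: of_real_diff)
    next
      case False
      then show ?thesis unfolding entry[OF ij] using eps by auto
    qed
  qed (use eps in simp)
  have 2: "op_norm (dominant * q' - v * q') \<le> 12 * \<epsilon> + 2 * sqrt (2 * \<epsilon>)"
    using op_norm_mult_diff_right[OF q(2) w v q1(2)] dominant_near
    unfolding op_norm_minus_commute[OF v w] by blast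
  have "(op_norm (v * q))\<^sup>2 \<le> 8 * \<epsilon>"
  proof -
    have qa: "mat_adjoint q = q"
      unfolding q_def mat_adjoint_mat_diag small_def by (intro eq_matI) auto
    have "mat_adjoint (v * q) * (v * q) = q * (p * q)"
      unfolding mat_adjoint_mult[OF v q(1)] qa assoc_mult_mat[OF q(1) va vq] assoc_mult_mat[OF va v q(1)] ..
    then have "(op_norm (v * q))\<^sup>2 \<le> op_norm (q * (p * q))" using op_norm_sq_le[OF vq] by simp
    also have "q * (p * q) = (q * (p * q) - q * (N * q)) + q * (N * q)"
      using q carrier_matD[OF p] by (intro eq_matI) auto
    also have "op_norm \<dots> \<le> op_norm (q * (p * q) - q * (N * q)) + op_norm (q * (N * q))"
      using q by (intro op_norm_triangle[of _ n] minus_carrier_mat) (auto intro!: mult_carrier_mat[of _ n n])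
    also have "op_norm (q * (p * q) - q * (N * q)) \<le> 2 * \<epsilon>"
      by (intro op_norm_mult_diff_left[OF q(1) _ _ q1(1)] op_norm_mult_diff_right[OF q(1) p _ q1(1)]
          p_near_N mult_carrier_mat[OF _ q(1)] p mat_diag_dim)
    also have "op_norm (q * (N * q)) \<le> 6 * \<epsilon>"
      unfolding q_def mat_diag_diag using mass_small[OF _ e] mass_nonneg eps
      by (intro op_norm_mat_diag_le) (auto simp: small_def)
    finally show ?thesis by simp
  qed
  then have "op_norm (v * q) \<le> sqrt (8 * \<epsilon>)" by (rule real_le_rsqrt)
  moreover have "v - v * q' = v * q"
    unfolding q_def q'_def mat_diag_mult_right[OF v] using v by (intro eq_matI) (auto simp: algebra_simps)
  ultimately have 3: "op_norm (v * q' - v) \<le> sqrt (8 * \<epsilon>)"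
    using op_norm_minus_commute[OF v vq'] by simp
  have "op_norm (rounding - v) \<le> (14 * \<epsilon> + (12 * \<epsilon> + 2 * sqrt (2 * \<epsilon>))) + sqrt (8 * \<epsilon>)"
    using r wq vq' v 1 2 3
    by (intro op_norm_diff_triangle[of rounding n "v * q'" v]
        op_norm_diff_triangle[of rounding n "dominant * q'" "v * q'"]) auto
  then show ?thesis by simp
qed

lemma rounding_entry_norm: "i < n \<Longrightarrow> j < n \<Longrightarrow> rounding $$ (i, j) \<noteq> 0 \<Longrightarrow> cmod (rounding $$ (i, j)) = 1"
  by (auto simp: rounding_def norm_divide split: if_splits)

lemma rounding_support: "i < n \<Longrightarrow> j < n \<Longrightarrow> rounding $$ (i, j) \<noteq> 0 \<Longrightarrow> v $$ (i, j) \<noteq> 0"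
  by (auto simp: rounding_def split: if_splits)

end

section \<open>Digraph algebras\<close>

text \<open>
  Reduces membership in a digraph algebra to a condition on the support, which any
  matrix with a smaller support inherits.
\<close>
lemma span_mat_units:
  assumes E: "E \<subseteq> {..<n} \<times> {..<n}"
  shows "LinearCombinations.module.span class_ring (module_mat TYPE(complex) n n) {mat_unit n i j | i j. (i, j) \<in> E}
       = {M \<in> carrier_mat n n. \<forall>i<n. \<forall>j<n. M $$ (i, j) \<noteq> 0 \<longrightarrow> (i, j) \<in> E}"
    (is "?span = ?supp")
proof
  let ?V = "module_mat TYPE(complex) n n"
  let ?U = "{mat_unit n i j | i j. (i, j) \<in> E}"
  interpret vectorspace "class_ring :: complex ring" ?V by (rule matrix_vs)
  have mod: "Module.module (class_ring :: complex ring) ?V" by unfold_locales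
  have "submodule class_ring ?supp ?V"
  proof (rule submodule.intro)
    show "Module.module (class_ring :: complex ring) ?V" by (rule mod)
    show "?supp \<subseteq> carrier ?V" by (auto simp: module_mat_simps)
    show "M \<oplus>\<^bsub>?V\<^esub> M' \<in> ?supp" if "M \<in> ?supp" "M' \<in> ?supp" for M M'
    proof -
      have "(i, j) \<in> E" if ij: "i < n" "j < n" "(M + M') $$ (i, j) \<noteq> 0" for i j
      proof -
        have "M $$ (i, j) \<noteq> 0 \<or> M' $$ (i, j) \<noteq> 0"
          using ij \<open>M' \<in> ?supp\<close> by auto
        moreover have "M $$ (i, j) \<noteq> 0 \<Longrightarrow> (i, j) \<in> E" "M' $$ (i, j) \<noteq> 0 \<Longrightarrow> (i, j) \<in> E"
          using ij \<open>M \<in> ?supp\<close> \<open>M' \<in> ?supp\<close> by simp_all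
        ultimately show ?thesis by argo
      qed
      moreover have "M + M' \<in> carrier_mat n n" using that by simp
      ultimately show ?thesis by (simp add: module_mat_simps)
    qed
    show "\<zero>\<^bsub>?V\<^esub> \<in> ?supp" by (simp add: module_mat_simps)
    show "c \<odot>\<^bsub>?V\<^esub> M \<in> ?supp" if "M \<in> ?supp" for c M
    proof -
      have "(i, j) \<in> E" if ij: "i < n" "j < n" "(c \<cdot>\<^sub>m M) $$ (i, j) \<noteq> 0" for i j
      proof -
        have "M $$ (i, j) \<noteq> 0" using ij \<open>M \<in> ?supp\<close> by auto
        then show ?thesis using ij \<open>M \<in> ?supp\<close> by simp
      qed
      moreover have "c \<cdot>\<^sub>m M \<in> carrier_mat n n" using that by simp
      ultimately show ?thesis by (simp add: module_mat_simps)
    qed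
  qed
  moreover have "?U \<subseteq> ?supp" by (auto simp: mat_unit_def split: if_splits)
  ultimately show "?span \<subseteq> ?supp" by (intro span_is_subset)
  have UC: "?U \<subseteq> carrier ?V" by (auto simp: mat_unit_def matrix_vs_simps)
  interpret S: submodule class_ring ?span ?V by (rule span_is_submodule[OF UC])
  have U: "mat_unit n i j \<in> ?span" if "(i, j) \<in> E" for i j
    using in_own_span[OF UC] that by blast
  show "?supp \<subseteq> ?span"
  proof
    fix M assume M: "M \<in> ?supp"
    have part: "mat n n (\<lambda>a. if a \<in> F then M $$ a else 0) \<in> ?span"
      if "finite F" "F \<subseteq> E" for F
      using that
    proof (induction F)
      case empty
      have "mat n n (\<lambda>a. if a \<in> {} then M $$ a else 0) = 0\<^sub>m n n"
        by (intro eq_matI) auto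
      then show ?case using S.zero_closed unfolding module_mat_simps by (simp only:)
    next
      case (insert e F)
      obtain i j where e: "e = (i, j)" by (cases e)
      have "mat n n (\<lambda>a. if a \<in> insert e F then M $$ a else 0)
        = mat n n (\<lambda>a. if a \<in> F then M $$ a else 0) + M $$ (i, j) \<cdot>\<^sub>m mat_unit n i j"
        using insert.hyps by (intro eq_matI) (auto simp: e mat_unit_def)
      moreover have "M $$ (i, j) \<cdot>\<^sub>m mat_unit n i j \<in> ?span"
        using S.smult_closed[OF _ U[of i j], of "M $$ (i, j)"] insert.prems e
        by (simp add: matrix_vs_simps)
      ultimately show ?case
        using S.m_closed insert.IH insert.prems by (simp add: matrix_vs_simps)
    qed
    have "finite E" using E by (rule finite_subset) simp
    moreover have "mat n n (\<lambda>a. if a \<in> E then M $$ a else 0) = M"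
    proof (rule eq_matI)
      fix i j assume "i < dim_row M" "j < dim_col M"
      moreover have "M \<in> carrier_mat n n" using M by simp
      ultimately have ij: "i < n" "j < n" by simp_all
      then have "M $$ (i, j) \<noteq> 0 \<longrightarrow> (i, j) \<in> E" using M by simp
      then show "mat n n (\<lambda>a. if a \<in> E then M $$ a else 0) $$ (i, j) = M $$ (i, j)"
        using ij by (cases "(i, j) \<in> E") simp_all
    qed (use M in auto)
    ultimately show "M \<in> ?span" using part[of E] by simp
  qed
qed

theorem proposition3p5:
  shows "\<exists>\<delta> :: real \<Rightarrow> real.
    (\<forall>\<epsilon>>0. 0 < \<delta> \<epsilon>) \<and>
    (\<delta> \<longlongrightarrow> 0) (at_right 0) \<and>
    (\<forall>(n :: nat) (\<A> :: complex mat set) (\<C> :: complex mat set) (\<epsilon> :: real) (v :: complex mat).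
       digraph_algebra n \<A> \<C> \<longrightarrow>
       0 < \<epsilon> \<longrightarrow>
       v \<in> \<A> \<longrightarrow>
       op_norm v \<le> 1 \<longrightarrow>
       approx_normalising \<C> \<epsilon> v \<longrightarrow>
       approx_partial_isometry \<epsilon> v \<longrightarrow>
       (\<exists>v' \<in> normaliser \<C> \<A>. op_norm (v' - v) < \<delta> \<epsilon>))"
proof (intro exI[of _ "\<lambda>\<epsilon>. 26 * \<epsilon> + 6 * sqrt \<epsilon>"] conjI allI impI)
  show "0 < 26 * \<epsilon> + 6 * sqrt \<epsilon>" if "0 < \<epsilon>" for \<epsilon> :: real
    using that by (simp add: add_pos_pos)
  have "((\<lambda>\<epsilon>. 26 * \<epsilon> + 6 * sqrt \<epsilon>) \<longlongrightarrow> 26 * 0 + 6 * sqrt 0) (at_right 0)"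
    by (intro tendsto_intros)
  then show "((\<lambda>\<epsilon>. 26 * \<epsilon> + 6 * sqrt \<epsilon>) \<longlongrightarrow> 0) (at_right 0)" by simp
next
  fix n \<A> \<C> and \<epsilon> :: real and v :: "complex mat"
  assume alg: "digraph_algebra n \<A> \<C>" and eps: "0 < \<epsilon>" and vA: "v \<in> \<A>" and v1: "op_norm v \<le> 1"
    and norm: "approx_normalising \<C> \<epsilon> v" and iso: "approx_partial_isometry \<epsilon> v"
  obtain E where E: "E \<subseteq> {..<n} \<times> {..<n}" and
    A: "\<A> = {M \<in> carrier_mat n n. \<forall>i<n. \<forall>j<n. M $$ (i, j) \<noteq> 0 \<longrightarrow> (i, j) \<in> E}"
    and C: "\<C> = diag_masa n"
    using alg span_mat_units unfolding digraph_algebra_def by auto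
  have v: "v \<in> carrier_mat n n" using vA A by simp
  interpret almost_normalising_isometry n \<epsilon> v
    by (rule almost_normalising_isometry.intro) (use v v1 eps norm iso C in simp_all)
  show "\<exists>v' \<in> normaliser \<C> \<A>. op_norm (v' - v) < 26 * \<epsilon> + 6 * sqrt \<epsilon>"
  proof (cases "\<epsilon> \<le> 1 / 8")
    case True
    have "rounding \<in> \<A>"
    proof -
      have "(i, j) \<in> E" if "i < n" "j < n" "rounding $$ (i, j) \<noteq> 0" for i j
        using rounding_support[OF that] vA that(1,2) unfolding A by simp
      moreover have "rounding \<in> carrier_mat n n" by (simp add: rounding_def)
      ultimately show ?thesis unfolding A by simp
    qed
    then have "rounding \<in> normaliser \<C> \<A>"
      unfolding C using rounding_entry_norm
      by (rule partial_matching_in_normaliser[OF rounding_matching[OF True]])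
    moreover have "sqrt (8 * \<epsilon>) = 2 * sqrt (2 * \<epsilon>)"
      using real_sqrt_mult[of 4 "2 * \<epsilon>"] by simp
    then have "op_norm (rounding - v) \<le> 26 * \<epsilon> + 4 * sqrt (2 * \<epsilon>)"
      using rounding_near[OF True] by simp
    moreover have "sqrt 2 < 3 / 2" by (rule real_less_lsqrt) (simp_all add: power2_eq_square)
    then have "4 * (sqrt 2 * sqrt \<epsilon>) < 4 * (3 / 2 * sqrt \<epsilon>)"
      using eps by (intro mult_strict_left_mono mult_strict_right_mono) auto
    then have "4 * sqrt (2 * \<epsilon>) < 6 * sqrt \<epsilon>" by (simp add: real_sqrt_mult)
    ultimately show ?thesis by force
  next
    case False
    have "0\<^sub>m n n \<in> normaliser \<C> \<A>"
      unfolding C by (rule partial_matching_in_normaliser) (simp_all add: partial_matching_def A)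
    moreover have "0\<^sub>m n n - v = (-1) \<cdot>\<^sub>m v" using v by (intro eq_matI) auto
    then have "op_norm (0\<^sub>m n n - v) \<le> 1" using op_norm_smult[OF v, of "-1"] v1 by simp
    moreover have "1 / 3 < sqrt \<epsilon>"
      using False by (intro real_less_rsqrt) (simp add: power2_eq_square)
    then have "1 < 26 * \<epsilon> + 6 * sqrt \<epsilon>" using eps by linarith
    ultimately show ?thesis by force
  qed
qed

end
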